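(* Let $\mathcal H$ be a real Hilbert space; let $A,C:\mathcal H\rightrightarrows\mathcal H$ be maximal monotone; let $\Omega\subset\mathcal H$ be nonempty, closed and convex and $F_1:D(F_1)\subset\mathcal H\to\mathcal H$ with $D(C)\subset\Omega\subset D(F_1)$ be monotone on $\Omega$ and satisfy $\|F_1(z)-F_1(z')\|\le L\|z-z'\|$ for all $z,z'\in\Omega$, where $L\ge0$; let $F_2:\mathcal H\to\mathcal H$ be $\eta$-cocoercive, $\eta>0$, i.e. $\langle F_2(z)-F_2(z'),z-z'\rangle\ge\eta\|F_2(z)-F_2(z')\|^2$ for all $z,z'\in\mathcal H$. Put $B:=C+F_1+F_2$ and assume $B^{-1}(0)\ne\emptyset$ and $(A+C+F_1+F_2)^{-1}(0)\neq\emptyset$. Let $z_0\in\mathcal H$, $\tau_0>0$, $0<\sigma,\theta<1$ and $0<\gamma\le\dfrac{4\eta\sigma^2}{1+\sqrt{1+16L^2\eta^2\sigma^2}}$ be the input of Algorithm 5 (described in the context), and assume $\max\{(1-\sigma)^{-1},\sigma^{-1}\}=\mathcal O(1)$. Let $d_{0,\gamma}$ be the distance from $z_0$ to $\mathrm{zer}(S_{\gamma,A,B})$ and $d_{0,b}$ the distance from $z_0$ to $B^{-1}(0)$. Then, for given tolerances $\rho,\epsilon>0$: (a) Algorithm 5 provides $a,b,x,y\in\mathcal H$ and $\varepsilon_a,\varepsilon_b\ge0$ such that $$a\in A^{\varepsilon_a}(y),\quad b\in (C+F_1+F_2)^{\varepsilon_b}(x),\quad \gamma\|a+b\|=\|x-y\|\le\rho,\quad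 \varepsilon_a+\varepsilon_b\le\epsilon\qquad( * )$$ after performing no more than $$k_{\mathrm{e;\,outer}}:=\mathcal O\left(1+\max\left\{\frac{d_{0,\gamma}}{\rho},\frac{d_{0,\gamma}^2}{\gamma\epsilon}\right\}+\max\left\{\log^+\left(\frac{\sqrt{\tau_0}}{\rho}\right),\log^+\left(\frac{\tau_0}{\gamma\epsilon}\right)\right\}\right)$$ outer iterations. (b) Before achieving the desired tolerances $\rho,\epsilon$, each (outer) iteration of Algorithm 5 performs at most $$k_{\mathrm{inner}}:=\mathcal O\left(1+\log^+\left(\frac{d_{0,\gamma}+d_{0,b}}{\sqrt{\tau_0}}\right)+\max\left\{\log^+\left(\frac{\sqrt{\tau_0}}{\rho}\right),\log^+\left(\frac{\tau_0}{\gamma\epsilon}\right)\right\}\right)$$ inner iterations, and hence at most that many evaluations of the $\eta$-cocoercive operator $F_2$. As a consequence, Algorithm 5 provides $a,b,x,y\in\mathcal H$ and $\varepsilon_a,\varepsilon_b\ge0$ satisfying $( * )$ after performing no more than $k_{\mathrm{e;\,outer}}\times k_{\mathrm{inner}}$ inner iterations.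
   Context: Enlargement: for $T:\mathcal H\rightrightarrows\mathcal H$ and $\varepsilon\ge0$, $T^{\varepsilon}(z):=\{v\in\mathcal H : \langle z-z',v-v'\rangle\ge-\varepsilon\ \text{for all } z',v' \text{ with } v'\in T(z')\}$. Operator $S_{\gamma,A,B}$: the maximal monotone operator on $\mathcal H$ with graph $\{(y+\gamma b,\gamma a+\gamma b) : b\in B(x),\ a\in A(y),\ \gamma a+y=x-\gamma b\}$; $\mathrm{zer}(S):=S^{-1}(0)$. Under the stated assumptions $B=C+F_1+F_2$ is maximal monotone. Algorithm 4 (inner, Tseng forward-backward type). Input $C,F_1,\Omega,L,F_2,\eta,\sigma,\gamma$ as in the claim, a point $\mathring z\in\mathcal H$ and $\mathring\tau>0$. Set $w_0=\mathring z$. For $j=1,2,\dots$ (each $j$ is an inner iteration): $w'_{j-1}=P_\Omega(w_{j-1})$ (orthogonal projection), $$\widetilde w_j=\left(\tfrac\gamma2C+I\right)^{-1}\left(\frac{\mathring z+w_{j-1}-\gamma(F_1+F_2)(w'_{j-1})}{2}\right),\qquad w_j=\widetilde w_j-\gamma\big(F_1(\widetilde w_j)-F_1(w'_{j-1})\big);$$ if $\|w_{j-1}-w_j\|^2+\frac{\gamma\|w'_{j-1}-\widetilde w_j\|^2}{2\eta}\le\mathring\tau$, terminate and output $(w_{j-1},w'_{j-1},w_j,\widetilde w_j)$. Algorithm 5 (Douglas-Rachford-Tseng four-operator splitting). For $k=1,2,\dots$ (outer iterations): (1) run Algorithm 4 with $(\mathring z,\mathring\tau)=(z_{k-1},\tau_{k-1})$,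 obtain $(w_{j-1},w'_{j-1},w_j,\widetilde w_j)$ and set $x_k=\widetilde w_j$, $b_k=\frac{z_{k-1}+w_{j-1}-(w_j+\widetilde w_j)}{\gamma}$, $\varepsilon_{b,k}=\frac{\|w'_{j-1}-\widetilde w_j\|^2}{4\eta}$; (2) compute $(y_k,a_k)$ with $a_k\in A(y_k)$ and $\gamma a_k+y_k=x_k-\gamma b_k$; (3) if $\|\gamma b_k+x_k-z_{k-1}\|^2+2\gamma\varepsilon_{b,k}\le\sigma^2\|\gamma b_k+y_k-z_{k-1}\|^2$, set $z_k=z_{k-1}-\gamma(a_k+b_k)$, $\tau_k=\tau_{k-1}$ (extragradient step); otherwise set $z_k=z_{k-1}$, $\tau_k=\theta\tau_{k-1}$ (null step). Ergodic sequences: let $k_1<k_2<\cdots$ be the indices of the extragradient steps. For each existing $k_j$ define $\overline x_{k_j}:=\frac1j\sum_{\ell=1}^jx_{k_\ell}$, $\overline y_{k_j}:=\frac1j\sum_{\ell=1}^jy_{k_\ell}$, $\overline a_{k_j}:=\frac1j\sum_{\ell=1}^ja_{k_\ell}$, $\overline b_{k_j}:=\frac1j\sum_{\ell=1}^jb_{k_\ell}$, $\overline\varepsilon_{a,k_j}:=\frac1j\sum_{\ell=1}^j\langle y_{k_\ell}-\overline y_{k_j},a_{k_\ell}-\overline a_{k_j}\rangle$, $\overline\varepsilon_{b,k_j}:=\frac1j\sum_{\ell=1}^j[\varepsilon_{b,k_\ell}+\langle x_{k_\ell}-\overline x_{k_j},b_{k_\ell}-\overline b_{k_j}\rangle]$.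 Conventions: $\log^+ t:=\max\{\log t,0\}$. "Provides within $N$ outer iterations" means that for some $k\le N$ the relations $( * )$ hold either for the ergodic iterates $(\overline a_{k},\overline b_{k},\overline x_{k},\overline y_{k},\overline\varepsilon_{a,k},\overline\varepsilon_{b,k})$ (when $k=k_j$ is an extragradient step) or for $(a_k,b_k,x_k,y_k,0,\varepsilon_{b,k})$ (when $k$ is a null step); "before achieving the desired tolerances" refers to the outer iterations up to and including the first such $k$. The assumption $\max\{(1-\sigma)^{-1},\sigma^{-1}\}=\mathcal O(1)$ means that this quantity is bounded by a fixed constant $M$; the constants implied by $\mathcal O(\cdot)$ depend only on $M$ and on $\theta$ (treated as fixed), and not on the operators, $\mathcal H,L,\eta,z_0,\gamma,\tau_0,\rho,\epsilon$. *)

theory Defs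
  imports "HOL-Analysis.Analysis"
begin

section \<open>Set-valued operators on a Hilbert space\<close>

text \<open>
  A real Hilbert space is a type of class \<open>real_inner\<close> and \<open>complete_space\<close>. A set-valued
  operator is a function \<open>T :: 'a \<Rightarrow> 'a set\<close>; its graph is \<open>{(z, v). v \<in> T z}\<close>.
\<close>

definition monotone_op :: "('a::real_inner \<Rightarrow> 'a set) \<Rightarrow> bool" where
  "monotone_op T \<longleftrightarrow> (\<forall>z z' v v'. v \<in> T z \<longrightarrow> v' \<in> T z' \<longrightarrow> 0 \<le> (z - z') \<bullet> (v - v'))"

definition maximal_monotone :: "('a::real_inner \<Rightarrow> 'a set) \<Rightarrow> bool" where
  "maximal_monotone T \<longleftrightarrow>
     monotone_op T \<and> (\<forall>T'. monotone_op T' \<and> (\<forall>z. T z \<subseteq> T' z) \<longrightarrow> T' = T)"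

definition op_dom :: "('a \<Rightarrow> 'a set) \<Rightarrow> 'a set" where
  "op_dom T = {z. T z \<noteq> {}}"

definition zer :: "('a::zero \<Rightarrow> 'a set) \<Rightarrow> 'a set" where
  "zer T = {z. 0 \<in> T z}"

definition op_sum :: "('a::plus \<Rightarrow> 'a set) \<Rightarrow> ('a \<Rightarrow> 'a set) \<Rightarrow> 'a \<Rightarrow> 'a set" where
  "op_sum S T z = {u + v |u v. u \<in> S z \<and> v \<in> T z}"

text \<open>A point-to-point map with domain \<open>D\<close>, viewed as a set-valued operator.\<close>

definition map_op :: "'a set \<Rightarrow> ('a \<Rightarrow> 'a) \<Rightarrow> 'a \<Rightarrow> 'a set" where
  "map_op D F z = (if z \<in> D then {F z} else {})"

definition enlargement :: "real \<Rightarrow> ('a::real_inner \<Rightarrow> 'a set) \<Rightarrow> 'a \<Rightarrow> 'a set" where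
  "enlargement \<epsilon> T z = {v. \<forall>z' v'. v' \<in> T z' \<longrightarrow> (z - z') \<bullet> (v - v') \<ge> - \<epsilon>}"

definition cocoercive :: "real \<Rightarrow> ('a::real_inner \<Rightarrow> 'a) \<Rightarrow> bool" where
  "cocoercive \<eta> F \<longleftrightarrow> (\<forall>z z'. (F z - F z') \<bullet> (z - z') \<ge> \<eta> * (norm (F z - F z'))\<^sup>2)"

text \<open>
  The value \<open>(c T + I)\<^sup>-\<^sup>1(u)\<close>. For \<open>c > 0\<close> and maximal monotone \<open>T\<close> it exists and is unique
  by Minty's theorem.
\<close>

definition resolvent :: "real \<Rightarrow> ('a::real_inner \<Rightarrow> 'a set) \<Rightarrow> 'a \<Rightarrow> 'a" where
  "resolvent c T u = (THE w. \<exists>v\<in>T w. c *\<^sub>R v + w = u)"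

text \<open>
  Orthogonal projection. The library's \<open>closest_point\<close> is confined to class \<open>heine_borel\<close>,
  i.e. to finite-dimensional spaces.
\<close>

definition proj :: "'a::real_inner set \<Rightarrow> 'a \<Rightarrow> 'a" where
  "proj \<Omega> u = (THE p. p \<in> \<Omega> \<and> (\<forall>q\<in>\<Omega>. dist u p \<le> dist u q))"

definition S_op ::
  "real \<Rightarrow> ('a::real_inner \<Rightarrow> 'a set) \<Rightarrow> ('a \<Rightarrow> 'a set) \<Rightarrow> 'a \<Rightarrow> 'a set" where
  "S_op \<gamma> A B z = {s. \<exists>x y a b. b \<in> B x \<and> a \<in> A y \<and> \<gamma> *\<^sub>R a + y = x - \<gamma> *\<^sub>R b \<and>
      z = y + \<gamma> *\<^sub>R b \<and> s = \<gamma> *\<^sub>R a + \<gamma> *\<^sub>R b}"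


section \<open>The Douglas-Rachford-Tseng four-operator splitting algorithm\<close>

text \<open>
  The locale only collects the input data and carries no assumptions. \<open>F1\<close> is a total function
  whose values are meaningful on its domain \<open>D1\<close> only.
\<close>

locale drt_splitting =
  fixes A C :: "'a::{real_inner,complete_space} \<Rightarrow> 'a set"
    and D1 :: "'a set" and F1 F2 :: "'a \<Rightarrow> 'a" and \<Omega> :: "'a set"
    and \<eta> \<sigma> \<theta> \<gamma> :: real and z0 :: 'a and \<tau>0 :: real
begin

definition B :: "'a \<Rightarrow> 'a set" where
  "B = op_sum (op_sum C (map_op D1 F1)) (map_op UNIV F2)"

subsection \<open>Inner loop, started at a point \<open>z\<close> with tolerance \<open>\<tau>\<close>\<close>

definition fb_step :: "'a \<Rightarrow> 'a \<Rightarrow> 'a" where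
  "fb_step z u = resolvent (\<gamma> / 2) C
     ((z + u - \<gamma> *\<^sub>R (F1 (proj \<Omega> u) + F2 (proj \<Omega> u))) /\<^sub>R 2)"

primrec w :: "'a \<Rightarrow> nat \<Rightarrow> 'a" where
  "w z 0 = z"
| "w z (Suc j) = fb_step z (w z j)
     - \<gamma> *\<^sub>R (F1 (fb_step z (w z j)) - F1 (proj \<Omega> (w z j)))"

definition w' :: "'a \<Rightarrow> nat \<Rightarrow> 'a" where
  "w' z j = proj \<Omega> (w z j)"

text \<open>\<open>wt z j\<close> is \<open>w\<close>-tilde with index \<open>j\<close>; it is meaningful for \<open>j \<ge> 1\<close>.\<close>

definition wt :: "'a \<Rightarrow> nat \<Rightarrow> 'a" where
  "wt z j = fb_step z (w z (j - 1))"

definition inner_stop :: "'a \<Rightarrow> real \<Rightarrow> nat \<Rightarrow> bool" where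
  "inner_stop z \<tau> j \<longleftrightarrow> 1 \<le> j \<and>
     (norm (w z (j - 1) - w z j))\<^sup>2 + \<gamma> * (norm (w' z (j - 1) - wt z j))\<^sup>2 / (2 * \<eta>) \<le> \<tau>"

text \<open>Number of inner iterations of one call; meaningful only if the loop terminates.\<close>

definition inner_iters :: "'a \<Rightarrow> real \<Rightarrow> nat" where
  "inner_iters z \<tau> = (LEAST j. inner_stop z \<tau> j)"

text \<open>
  The successive points at which one call evaluates \<open>F2\<close>; inner iteration \<open>j\<close> evaluates it at
  \<open>w' z (j - 1)\<close> and nowhere else, and the outer loop does not evaluate it at all.
\<close>

definition F2_queries :: "'a \<Rightarrow> real \<Rightarrow> 'a list" where
  "F2_queries z \<tau> = map (\<lambda>j. w' z (j - 1)) [1..<Suc (inner_iters z \<tau>)]"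

subsection \<open>One outer iteration, from the state \<open>(z, \<tau>)\<close>\<close>

definition out_x :: "'a \<Rightarrow> real \<Rightarrow> 'a" where
  "out_x z \<tau> = wt z (inner_iters z \<tau>)"

definition out_b :: "'a \<Rightarrow> real \<Rightarrow> 'a" where
  "out_b z \<tau> = (let j = inner_iters z \<tau> in (z + w z (j - 1) - (w z j + wt z j)) /\<^sub>R \<gamma>)"

definition out_eps :: "'a \<Rightarrow> real \<Rightarrow> real" where
  "out_eps z \<tau> = (let j = inner_iters z \<tau> in (norm (w' z (j - 1) - wt z j))\<^sup>2 / (4 * \<eta>))"

text \<open>The pair \<open>(y, a)\<close>, unique and existing for maximal monotone \<open>A\<close> and \<open>\<gamma> > 0\<close>.\<close>

definition out_ya :: "'a \<Rightarrow> real \<Rightarrow> 'a \<times> 'a" where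
  "out_ya z \<tau> = (THE ya. snd ya \<in> A (fst ya) \<and>
      \<gamma> *\<^sub>R snd ya + fst ya = out_x z \<tau> - \<gamma> *\<^sub>R out_b z \<tau>)"

definition out_y :: "'a \<Rightarrow> real \<Rightarrow> 'a" where
  "out_y z \<tau> = fst (out_ya z \<tau>)"

definition out_a :: "'a \<Rightarrow> real \<Rightarrow> 'a" where
  "out_a z \<tau> = snd (out_ya z \<tau>)"

definition accept :: "'a \<Rightarrow> real \<Rightarrow> bool" where
  "accept z \<tau> \<longleftrightarrow>
     (norm (\<gamma> *\<^sub>R out_b z \<tau> + out_x z \<tau> - z))\<^sup>2 + 2 * \<gamma> * out_eps z \<tau>
       \<le> \<sigma>\<^sup>2 * (norm (\<gamma> *\<^sub>R out_b z \<tau> + out_y z \<tau> - z))\<^sup>2"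

subsection \<open>The sequences generated by the algorithm\<close>

text \<open>\<open>state k\<close> is the pair of \<open>z\<close> and \<open>\<tau>\<close> after \<open>k\<close> outer iterations.\<close>

primrec state :: "nat \<Rightarrow> 'a \<times> real" where
  "state 0 = (z0, \<tau>0)"
| "state (Suc k) = (let z = fst (state k); \<tau> = snd (state k) in
     if accept z \<tau> then (z - \<gamma> *\<^sub>R (out_a z \<tau> + out_b z \<tau>), \<tau>)
     else (z, \<theta> * \<tau>))"

definition zs :: "nat \<Rightarrow> 'a" where "zs k = fst (state k)"
definition \<tau>s :: "nat \<Rightarrow> real" where "\<tau>s k = snd (state k)"

text \<open>Data of outer iteration \<open>k \<ge> 1\<close>.\<close>

definition xs :: "nat \<Rightarrow> 'a" where "xs k = out_x (zs (k - 1)) (\<tau>s (k - 1))"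
definition bs :: "nat \<Rightarrow> 'a" where "bs k = out_b (zs (k - 1)) (\<tau>s (k - 1))"
definition ys :: "nat \<Rightarrow> 'a" where "ys k = out_y (zs (k - 1)) (\<tau>s (k - 1))"
definition as :: "nat \<Rightarrow> 'a" where "as k = out_a (zs (k - 1)) (\<tau>s (k - 1))"
definition eps_b :: "nat \<Rightarrow> real" where "eps_b k = out_eps (zs (k - 1)) (\<tau>s (k - 1))"

definition extragradient :: "nat \<Rightarrow> bool" where
  "extragradient k \<longleftrightarrow> 1 \<le> k \<and> accept (zs (k - 1)) (\<tau>s (k - 1))"

definition inner_terminates :: "nat \<Rightarrow> bool" where
  "inner_terminates k \<longleftrightarrow> (\<exists>j. inner_stop (zs (k - 1)) (\<tau>s (k - 1)) j)"

definition inner_count :: "nat \<Rightarrow> nat" where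
  "inner_count k = inner_iters (zs (k - 1)) (\<tau>s (k - 1))"

definition F2_evals :: "nat \<Rightarrow> nat" where
  "F2_evals k = length (F2_queries (zs (k - 1)) (\<tau>s (k - 1)))"

subsection \<open>Ergodic sequences\<close>

text \<open>
  If \<open>k\<close> is the \<open>j\<close>-th extragradient step, then \<open>E k\<close> collects the indices of the first \<open>j\<close>
  extragradient steps.
\<close>

definition E :: "nat \<Rightarrow> nat set" where
  "E k = {l. l \<le> k \<and> extragradient l}"

definition mean :: "(nat \<Rightarrow> 'v::real_vector) \<Rightarrow> nat \<Rightarrow> 'v" where
  "mean u k = (\<Sum>l\<in>E k. u l) /\<^sub>R real (card (E k))"

definition erg_eps_a :: "nat \<Rightarrow> real" where
  "erg_eps_a k = mean (\<lambda>l. (ys l - mean ys k) \<bullet> (as l - mean as k)) k"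

definition erg_eps_b :: "nat \<Rightarrow> real" where
  "erg_eps_b k = mean (\<lambda>l. eps_b l + (xs l - mean xs k) \<bullet> (bs l - mean bs k)) k"

subsection \<open>Desired tolerances\<close>

definition tolerances ::
  "real \<Rightarrow> real \<Rightarrow> 'a \<Rightarrow> 'a \<Rightarrow> 'a \<Rightarrow> 'a \<Rightarrow> real \<Rightarrow> real \<Rightarrow> bool" where
  "tolerances \<rho> \<epsilon> a b x y \<epsilon>a \<epsilon>b \<longleftrightarrow>
     0 \<le> \<epsilon>a \<and> 0 \<le> \<epsilon>b \<and> a \<in> enlargement \<epsilon>a A y \<and> b \<in> enlargement \<epsilon>b B x \<and>
     \<gamma> * norm (a + b) = norm (x - y) \<and> norm (x - y) \<le> \<rho> \<and> \<epsilon>a + \<epsilon>b \<le> \<epsilon>"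

definition achieved :: "real \<Rightarrow> real \<Rightarrow> nat \<Rightarrow> bool" where
  "achieved \<rho> \<epsilon> k \<longleftrightarrow>
     (if extragradient k
      then tolerances \<rho> \<epsilon> (mean as k) (mean bs k) (mean xs k) (mean ys k)
             (erg_eps_a k) (erg_eps_b k)
      else tolerances \<rho> \<epsilon> (as k) (bs k) (xs k) (ys k) 0 (eps_b k))"

end


section \<open>Complexity bounds\<close>

definition log_plus :: "real \<Rightarrow> real" where
  "log_plus t = (if t \<le> 0 then 0 else max (ln t) 0)"

text \<open>
  The constants hidden in the two \<open>O\<close>-bounds, as functions of \<open>\<theta>\<close> and of a bound \<open>M\<close> on
  \<open>max {1/(1-\<sigma>), 1/\<sigma>}\<close>. They must not depend on the Hilbert space. As type variables are
  quantified outside of every formula, a constant introduced by an existential quantifier could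
  depend on the type \<open>'a\<close>; hence the constants are given in closed form.
\<close>

definition outer_const :: "real \<Rightarrow> real \<Rightarrow> real" where
  "outer_const M \<theta> = 5 * M * (1 + 1 / ln (1 / \<theta>))"

definition inner_const :: "real \<Rightarrow> real \<Rightarrow> real" where
  "inner_const M \<theta> = 10 * M\<^sup>2 * (1 + ln (1 / \<theta>))"

text \<open>Here \<open>d\<gamma>\<close> and \<open>db\<close> are the distances of the initial point to the two solution sets.\<close>

definition k_outer ::
  "real \<Rightarrow> real \<Rightarrow> real \<Rightarrow> real \<Rightarrow> real \<Rightarrow> real \<Rightarrow> real \<Rightarrow> real" where
  "k_outer M \<theta> \<gamma> \<tau>0 d\<gamma> \<rho> \<epsilon> = outer_const M \<theta> *
     (1 + max (d\<gamma> / \<rho>) (d\<gamma>\<^sup>2 / (\<gamma> * \<epsilon>))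
        + max (log_plus (sqrt \<tau>0 / \<rho>)) (log_plus (\<tau>0 / (\<gamma> * \<epsilon>))))"

definition k_inner ::
  "real \<Rightarrow> real \<Rightarrow> real \<Rightarrow> real \<Rightarrow> real \<Rightarrow> real \<Rightarrow> real \<Rightarrow> real \<Rightarrow> real" where
  "k_inner M \<theta> \<gamma> \<tau>0 d\<gamma> db \<rho> \<epsilon> = inner_const M \<theta> *
     (1 + log_plus ((d\<gamma> + db) / sqrt \<tau>0)
        + max (log_plus (sqrt \<tau>0 / \<rho>)) (log_plus (\<tau>0 / (\<gamma> * \<epsilon>))))"

end

theory Submission
  imports Defs
begin

text \<open>
  Inner loop: the proximal point \<open>p\<close> of \<open>\<gamma> B\<close> at \<open>z\<close> satisfies \<open>|z - p| \<le> |z - q|\<close> for all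
  zeros \<open>q\<close> of \<open>B\<close>. Strong monotonicity of \<open>\<gamma> B + I\<close> makes \<open>|w\<^sub>j - p|\<^sup>2\<close> decay at the rate
  \<open>(1 + \<sigma>\<^sup>2) / (3 - \<sigma>\<^sup>2)\<close>, and this quantity dominates the residual in the stopping test; hence
  the logarithmic number of inner iterations.

  Outer loop: an extragradient step is a relative-error hybrid proximal extragradient step for
  \<open>S\<close>, so the \<open>z\<^sub>k\<close> are Fejer monotone with respect to the zeros of \<open>S\<close> and the ergodic residuals
  after \<open>N\<close> such steps are \<open>O(d / N)\<close> and \<open>O(d\<^sup>2 / (\<gamma> N))\<close>. A failed relative-error test bounds the
  residuals of a null step by \<open>(1 + 1 / \<sigma>) sqrt \<tau>\<close> and \<open>\<tau> / (2 \<gamma>)\<close>, and \<open>\<tau>\<close> shrinks by \<open>\<theta>\<close> each time;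
  so both kinds of steps can occur only a bounded number of times before the tolerances are met,
  and until then \<open>\<tau>\<close> stays bounded below.

  Minty's theorem (existence of resolvents) is obtained by minimizing the Fitzpatrick function
  plus half the squared norm. Distances to the solution sets are never attained explicitly: every
  estimate holds for each solution and is then passed to the infimum.
\<close>

section \<open>Resolvents and projections\<close>

text \<open>\<open>t + (norm p)\<^sup>2 / 2\<close> is strongly convex in \<open>p\<close>, so
  completeness replaces compactness in the search for a minimizer over \<open>K\<close>; the
  conclusion is its first-order optimality condition. The linear coordinate \<open>t\<close> lets
  one statement serve an epigraph (Minty) and, frozen at 0, a translated convex set
  (projection).\<close>

lemma quadratic_minimizer:
  fixes K :: "('b::{real_inner,complete_space} \<times> real) set"
  assumes "closed K" "convex K" "K \<noteq> {}"
    and lower: "\<And>p t. (p, t) \<in> K \<Longrightarrow> l \<le> t + (norm p)\<^sup>2 / 2"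
  obtains p0 t0 where "(p0, t0) \<in> K"
    and "\<And>p t. (p, t) \<in> K \<Longrightarrow> t0 \<le> t + p0 \<bullet> (p - p0)"
proof -
  define g where "g = (\<lambda>q::'b \<times> real. snd q + (norm (fst q))\<^sup>2 / 2)"
  define m where "m = Inf (g ` K)"
  have bdd: "bdd_below (g ` K)"
    using lower by (force simp: g_def intro!: bdd_belowI2[of K l])
  have m_le: "m \<le> g q" if "q \<in> K" for q
    unfolding m_def using bdd that by (intro cInf_lower) auto
  have "\<exists>q\<in>K. g q < m + 1 / real (Suc n)" for n
  proof -
    have "Inf (g ` K) < m + 1 / real (Suc n)" by (simp add: m_def)
    then show ?thesis using cInf_lessD[of "g ` K"] assms(3) by auto
  qed
  then obtain q where qK: "\<And>n. q n \<in> K" and q_lt: "\<And>n. g (q n) < m + 1 / real (Suc n)"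
    by metis
  define p where "p = (\<lambda>n. fst (q n))"
  \<comment> \<open>Parallelogram law: the midpoint of two near-minimizers lies in \<open>K\<close>
    and cannot fall below \<open>m\<close>, so their distance is controlled by their excess over
    \<open>m\<close>.\<close>
  have close: "(norm (p i - p j))\<^sup>2 \<le> 8 / real (Suc n)" if "n \<le> i" "n \<le> j" for i j n
  proof -
    have "(1/2) *\<^sub>R q i + (1/2) *\<^sub>R q j \<in> K"
      using convexD[OF assms(2) qK qK, of "1/2" "1/2" i j] by simp
    then have "m \<le> g ((1/2) *\<^sub>R q i + (1/2) *\<^sub>R q j)" by (rule m_le)
    also have "\<dots> = (g (q i) + g (q j)) / 2 - (norm (p i - p j))\<^sup>2 / 8"
      unfolding g_def p_def power2_norm_eq_inner
      by (simp add: inner_simps inner_commute field_simps)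
    finally have "(norm (p i - p j))\<^sup>2 \<le> 4 * (g (q i) - m) + 4 * (g (q j) - m)"
      by (simp add: field_simps)
    moreover define r where "r = 1 / real (Suc n)"
    have "g (q i) - m \<le> r" "g (q j) - m \<le> r"
      using q_lt[of i] q_lt[of j] that frac_le[of 1 1 "real (Suc n)" "real (Suc i)"]
        frac_le[of 1 1 "real (Suc n)" "real (Suc j)"] by (auto simp: r_def)
    ultimately have "(norm (p i - p j))\<^sup>2 \<le> 4 * r + 4 * r" by (smt (verit))
    then have "(norm (p i - p j))\<^sup>2 \<le> 8 * r" by simp
    then show ?thesis by (simp add: r_def)
  qed
  have "Cauchy p"
  proof (rule metric_CauchyI)
    fix e :: real assume "0 < e"
    obtain n where n: "8 / e\<^sup>2 < real n" using reals_Archimedean2 by blast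
    then have n': "8 < e\<^sup>2 * real n" using \<open>0 < e\<close> by (simp add: field_simps)
    then have "e\<^sup>2 * real n \<le> e\<^sup>2 * real (Suc n)" using \<open>0 < e\<close> by simp
    with n' have "8 < e\<^sup>2 * real (Suc n)" by (rule order_less_le_trans)
    then have lt: "8 / real (Suc n) < e\<^sup>2" by (simp only: pos_divide_less_eq of_nat_0_less_iff zero_less_Suc)
    have "dist (p i) (p j) < e" if "n \<le> i" "n \<le> j" for i j
      using close[OF that] lt \<open>0 < e\<close> by (metis dist_norm less_eq_real_def order_le_less_trans power2_less_imp_less)
    then show "\<exists>M. \<forall>i\<ge>M. \<forall>j\<ge>M. dist (p i) (p j) < e" by blast
  qed
  then obtain p0 where p0: "p \<longlonglongrightarrow> p0"
    using Cauchy_convergent convergent_def by blast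
  define t0 where "t0 = m - (norm p0)\<^sup>2 / 2"
  have "(\<lambda>n. g (q n)) \<longlonglongrightarrow> m"
  proof (rule tendsto_sandwich[OF _ _ tendsto_const])
    show "(\<lambda>n. m + 1 / real (Suc n)) \<longlonglongrightarrow> m"
      using tendsto_add[OF tendsto_const[of m] LIMSEQ_inverse_real_of_nat] by (simp add: field_simps)
  qed (use m_le qK q_lt in \<open>auto intro!: always_eventually less_imp_le\<close>)
  \<comment> \<open>The second coordinates converge as well, being \<open>g\<close> minus half the
    squared norm; so closedness of \<open>K\<close> applies to the full pairs.\<close>
  then have "(\<lambda>n. (p n, g (q n) - (norm (p n))\<^sup>2 / 2)) \<longlonglongrightarrow> (p0, t0)"
    unfolding t0_def by (intro tendsto_intros p0) auto
  moreover have "(p n, g (q n) - (norm (p n))\<^sup>2 / 2) = q n" for n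
    by (simp add: p_def g_def prod_eq_iff)
  ultimately have q_lim: "q \<longlonglongrightarrow> (p0, t0)" by simp
  have in_K: "(p0, t0) \<in> K"
    using closed_sequentially[OF assms(1) _ q_lim] qK by blast
  have "t0 \<le> t + p0 \<bullet> (p - p0)" if "(p, t) \<in> K" for p t
  proof (rule ccontr)
    define e where "e = t0 - t - p0 \<bullet> (p - p0)"
    \<comment> \<open>Moving a fraction \<open>s\<close> towards \<open>(p, t)\<close> changes
      \<open>g\<close> by \<open>s * (s * (norm (p - p0))\<^sup>2 / 2 - e)\<close>; this choice
      makes the change negative. The added 1 avoids division by zero.\<close>
    define s where "s = min 1 (e / ((norm (p - p0))\<^sup>2 + 1))"
    assume "\<not> ?thesis"
    then have "0 < e" by (simp add: e_def)
    have D: "0 < (norm (p - p0))\<^sup>2 + 1" by (simp add: add_nonneg_pos)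
    have s: "0 < s" "s \<le> 1" using \<open>0 < e\<close> D by (auto simp: s_def)
    have "s \<le> e / ((norm (p - p0))\<^sup>2 + 1)" by (simp add: s_def)
    then have "s * ((norm (p - p0))\<^sup>2 + 1) \<le> e" using D by (simp add: pos_le_divide_eq)
    then have small: "s * (norm (p - p0))\<^sup>2 < e" using s by (simp add: distrib_left)
    have "(1 - s) *\<^sub>R (p0, t0) + s *\<^sub>R (p, t) \<in> K"
      using convexD[OF assms(2) in_K that, of "1 - s" s] s by simp
    then have "m \<le> g ((1 - s) *\<^sub>R (p0, t0) + s *\<^sub>R (p, t))" by (rule m_le)
    also have "\<dots> = m + s * (s * (norm (p - p0))\<^sup>2 / 2 - e)"
      unfolding g_def t0_def e_def power2_norm_eq_inner
      by (simp add: inner_simps inner_commute field_simps power2_eq_square)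
    finally have "0 \<le> s * (norm (p - p0))\<^sup>2 / 2 - e" using s by (simp add: zero_le_mult_iff)
    then show False using small \<open>0 < e\<close> by linarith
  qed
  with in_K show thesis by (rule that)
qed

text \<open>Adjoining the pair \<open>(x, v)\<close> to the graph preserves monotonicity, so
  maximality forces it to be there already.\<close>

lemma maximal_monotone_mem:
  assumes "maximal_monotone T" and rel: "\<And>y w. w \<in> T y \<Longrightarrow> 0 \<le> (x - y) \<bullet> (v - w)"
  shows "v \<in> T x"
proof -
  define T' where "T' = T(x := insert v (T x))"
  have mono: "0 \<le> (y - z) \<bullet> (u - w)" if "u \<in> T y" "w \<in> T z" for y z u w
    using assms(1) that by (auto simp: maximal_monotone_def monotone_op_def)
  have "0 \<le> (y - x) \<bullet> (w - v)" if "w \<in> T y" for y w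
    using rel[OF that] by (simp add: inner_simps algebra_simps)
  then have "monotone_op T'"
    using mono rel by (auto simp: monotone_op_def T'_def)
  moreover have "\<forall>z. T z \<subseteq> T' z" by (auto simp: T'_def)
  ultimately have "T' = T" using assms(1) by (auto simp: maximal_monotone_def)
  then show ?thesis by (metis T'_def fun_upd_same insertI1)
qed

text \<open>The set \<open>K\<close> is the epigraph of the Fitzpatrick function of \<open>T\<close>.\<close>

lemma minty_zero:
  fixes T :: "'a::{real_inner,complete_space} \<Rightarrow> 'a set"
  assumes T: "maximal_monotone T"
  obtains y where "- y \<in> T y"
proof -
  define K :: "(('a \<times> 'a) \<times> real) set"
    where "K = (\<Inter>(y, w)\<in>{(y, w). w \<in> T y}. {q. ((w, y), -1) \<bullet> q \<le> y \<bullet> w})"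
  have K_iff: "((x, v), t) \<in> K \<longleftrightarrow> (\<forall>y w. w \<in> T y \<longrightarrow> x \<bullet> w + y \<bullet> v - y \<bullet> w \<le> t)" for x v t
    by (auto simp: K_def inner_commute algebra_simps)
  have mono: "0 \<le> (y - z) \<bullet> (u - w)" if "u \<in> T y" "w \<in> T z" for y z u w
    using T that by (auto simp: maximal_monotone_def monotone_op_def)
  have graph: "((y, w), y \<bullet> w) \<in> K" if "w \<in> T y" for y w
    unfolding K_iff
  proof (intro allI impI)
    fix z u assume "u \<in> T z"
    from mono[OF that this] show "y \<bullet> u + z \<bullet> w - z \<bullet> u \<le> y \<bullet> w"
      by (simp add: inner_simps)
  qed
  \<comment> \<open>A value below the pairing would make \<open>(x, v)\<close> monotonically related
    to the graph, hence a member of it; testing the epigraph condition with \<open>(x, v)\<close>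
    itself then contradicts the assumption.\<close>
  have below: "x \<bullet> v \<le> t" if "((x, v), t) \<in> K" for x v t
  proof (rule ccontr)
    assume "\<not> x \<bullet> v \<le> t"
    then have "0 \<le> (x - y) \<bullet> (v - w)" if "w \<in> T y" for y w
      using \<open>((x, v), t) \<in> K\<close>[unfolded K_iff, rule_format, OF that]
      by (auto simp: inner_simps inner_commute algebra_simps)
    then have "v \<in> T x" by (rule maximal_monotone_mem[OF T])
    then have "x \<bullet> v + x \<bullet> v - x \<bullet> v \<le> t" using that unfolding K_iff by blast
    with \<open>\<not> x \<bullet> v \<le> t\<close> show False by simp
  qed
  obtain x0 v0 t0 where min: "((x0, v0), t0) \<in> K"
    and opt: "\<And>x v t. ((x, v), t) \<in> K \<Longrightarrow> t0 \<le> t + (x0, v0) \<bullet> ((x, v) - (x0, v0))"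
  proof (rule quadratic_minimizer[of K 0])
    show "closed K" unfolding K_def by (intro closed_INT ballI) (auto simp: closed_halfspace_le)
    show "convex K" unfolding K_def by (intro convex_INT) (auto simp: convex_halfspace_le)
    \<comment> \<open>If the graph were empty, \<open>(0, 0)\<close> would be vacuously related to
      it and so belong to it.\<close>
    have "\<exists>y w. w \<in> T y"
      using maximal_monotone_mem[OF T, of 0 0] by blast
    then show "K \<noteq> {}" using graph by blast
    show "0 \<le> t + (norm p)\<^sup>2 / 2" if "(p, t) \<in> K" for p t
    proof -
      obtain x v where p: "p = (x, v)" by force
      have "0 \<le> (norm (x + v))\<^sup>2 / 2" by simp
      also have "\<dots> = x \<bullet> v + (norm p)\<^sup>2 / 2"
        unfolding p power2_norm_eq_inner by (simp add: inner_simps inner_commute field_simps)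
      finally show ?thesis using below that p by force
    qed
  qed (use that in force)
  \<comment> \<open>Optimality tested at graph points, together with
    \<open>x0 \<bullet> v0 \<le> t0\<close>, completes a square. Hence \<open>(- v0, - x0)\<close>
    lies in the graph, and inserting this pair itself gives \<open>x0 + v0 = 0\<close>.\<close>
  have sq: "(norm (x0 + v0))\<^sup>2 \<le> (- v0 - y) \<bullet> (- x0 - w)" if "w \<in> T y" for y w
    using opt[OF graph[OF that]] below[OF min]
    by (simp add: power2_norm_eq_inner inner_simps inner_commute algebra_simps)
  then have "- x0 \<in> T (- v0)"
    by (intro maximal_monotone_mem[OF T]) (meson order_trans zero_le_power2)
  moreover from sq[OF this] have "x0 = - v0" by (simp add: add_eq_0_iff2)
  ultimately show thesis using that by fastforce
qed

text \<open>Passing to \<open>T'\<close>, with values \<open>c T y - u\<close>, preserves maximal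
  monotonicity, and \<open>- y \<in> T' y\<close> is the required equation.\<close>

lemma minty:
  fixes T :: "'a::{real_inner,complete_space} \<Rightarrow> 'a set"
  assumes T: "maximal_monotone T" and "0 < c"
  obtains y v where "v \<in> T y" "c *\<^sub>R v + y = u"
proof -
  define T' where "T' = (\<lambda>y. {c *\<^sub>R v - u | v. v \<in> T y})"
  have "maximal_monotone T'"
    unfolding maximal_monotone_def
  proof (intro conjI allI impI)
    have mono: "0 \<le> (y - z) \<bullet> (v - w)" if "v \<in> T y" "w \<in> T z" for y z v w
      using T that by (auto simp: maximal_monotone_def monotone_op_def)
    have "(y - z) \<bullet> ((c *\<^sub>R v - u) - (c *\<^sub>R w - u)) = c * ((y - z) \<bullet> (v - w))" for y z v w :: 'a
      by (simp add: inner_simps algebra_simps)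
    then show "monotone_op T'"
      using mono \<open>0 < c\<close> by (auto simp: monotone_op_def T'_def)
    fix S assume S: "monotone_op S \<and> (\<forall>z. T' z \<subseteq> S z)"
    have "s \<in> T' x" if "s \<in> S x" for s x
    proof -
      have "0 \<le> (x - y) \<bullet> ((s + u) /\<^sub>R c - w)" if "w \<in> T y" for y w
      proof -
        have "c *\<^sub>R w - u \<in> S y" using S that by (auto simp: T'_def)
        then have "0 \<le> (x - y) \<bullet> (s - (c *\<^sub>R w - u))"
          using S \<open>s \<in> S x\<close> by (auto simp: monotone_op_def)
        also have "s - (c *\<^sub>R w - u) = c *\<^sub>R ((s + u) /\<^sub>R c - w)"
          using \<open>0 < c\<close> by (simp add: algebra_simps)
        finally show ?thesis using \<open>0 < c\<close> by (simp add: zero_le_mult_iff)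
      qed
      then have "(s + u) /\<^sub>R c \<in> T x" by (rule maximal_monotone_mem[OF T])
      moreover have "s = c *\<^sub>R ((s + u) /\<^sub>R c) - u" using \<open>0 < c\<close> by simp
      ultimately show ?thesis unfolding T'_def by blast
    qed
    then show "S = T'" using S by (intro ext) blast
  qed
  then obtain y where "- y \<in> T' y" by (rule minty_zero)
  then obtain v where "v \<in> T y" "- y = c *\<^sub>R v - u" by (auto simp: T'_def)
  then show thesis using that[of v y] by (metis diff_add_cancel add.commute add_diff_cancel_left' diff_minus_eq_add)
qed

lemma resolvent_nonexpansive:
  assumes "monotone_op T" "0 \<le> c" "v \<in> T y" "v' \<in> T y'"
  shows "norm (y - y') \<le> norm ((c *\<^sub>R v + y) - (c *\<^sub>R v' + y'))"
proof -
  have "0 \<le> c * ((y - y') \<bullet> (v - v'))"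
    using assms by (auto simp: monotone_op_def)
  then have "(norm (y - y'))\<^sup>2 \<le> (y - y') \<bullet> ((c *\<^sub>R v + y) - (c *\<^sub>R v' + y'))"
    by (simp add: power2_norm_eq_inner inner_simps algebra_simps)
  also have "\<dots> \<le> norm (y - y') * norm ((c *\<^sub>R v + y) - (c *\<^sub>R v' + y'))"
    by (rule norm_cauchy_schwarz)
  finally show ?thesis
    by (cases "y = y'") (simp_all add: power2_eq_square)
qed

text \<open>\<open>minty\<close> gives existence; nonexpansiveness gives uniqueness, since equal
  right-hand sides force equal points. Both are needed to unfold the definite description.\<close>

lemma resolvent_mem:
  fixes T :: "'a::{real_inner,complete_space} \<Rightarrow> 'a set"
  assumes "maximal_monotone T" "0 < c"
  obtains v where "v \<in> T (resolvent c T u)" "c *\<^sub>R v + resolvent c T u = u"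
proof -
  obtain y v where y: "v \<in> T y" "c *\<^sub>R v + y = u" using minty[OF assms] by blast
  have "\<exists>v\<in>T (resolvent c T u). c *\<^sub>R v + resolvent c T u = u"
    unfolding resolvent_def
  proof (rule theI)
    show "\<exists>v\<in>T y. c *\<^sub>R v + y = u" using y by blast
    fix y' assume "\<exists>v\<in>T y'. c *\<^sub>R v + y' = u"
    then obtain v' where "v' \<in> T y'" "c *\<^sub>R v' + y' = u" by blast
    then show "y' = y"
      using resolvent_nonexpansive[of T c v' y' v y] y assms by (auto simp: maximal_monotone_def)
  qed
  then show thesis using that by blast
qed

text \<open>The minimizer over the translate of \<Omega> by \<open>- u\<close> is its point of least
  norm, and the optimality condition is the variational inequality. The resulting Pythagorean
  inequality \<open>dist_p\<close> gives uniqueness.\<close>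

lemma proj_mem_inner:
  fixes \<Omega> :: "'a::{real_inner,complete_space} set"
  assumes "\<Omega> \<noteq> {}" "closed \<Omega>" "convex \<Omega>"
  shows "proj \<Omega> u \<in> \<Omega>" "\<And>q. q \<in> \<Omega> \<Longrightarrow> 0 \<le> (proj \<Omega> u - u) \<bullet> (q - proj \<Omega> u)"
proof -
  obtain d t where "(d, t) \<in> ((\<lambda>q. q - u) ` \<Omega>) \<times> {0::real}"
    and "\<And>d' t'. (d', t') \<in> ((\<lambda>q. q - u) ` \<Omega>) \<times> {0} \<Longrightarrow> t \<le> t' + d \<bullet> (d' - d)"
  proof (rule quadratic_minimizer[of "((\<lambda>q. q - u) ` \<Omega>) \<times> {0}" 0])
    show "closed (((\<lambda>q. q - u) ` \<Omega>) \<times> {0::real})"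
      using assms by (intro closed_Times closed_translation_subtract) auto
    show "convex (((\<lambda>q. q - u) ` \<Omega>) \<times> {0::real})"
      using assms by (intro convex_Times convex_translation_subtract) auto
  qed (use assms in auto)
  then obtain p where p: "p \<in> \<Omega>"
    and "\<And>d'. d' \<in> (\<lambda>q. q - u) ` \<Omega> \<Longrightarrow> 0 \<le> (p - u) \<bullet> (d' - (p - u))"
    by auto
  then have inn: "0 \<le> (p - u) \<bullet> (q - p)" if "q \<in> \<Omega>" for q
    using that by force
  have dist_p: "(dist u p)\<^sup>2 + (dist p q)\<^sup>2 \<le> (dist u q)\<^sup>2" if "q \<in> \<Omega>" for q
    using inn[OF that]
    by (simp add: dist_norm power2_norm_eq_inner inner_simps inner_commute algebra_simps)
  have "proj \<Omega> u = p"
    unfolding proj_def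
  proof (rule the_equality)
    have "dist u p \<le> dist u q" if "q \<in> \<Omega>" for q
      using dist_p[OF that] by (smt (verit) power2_le_imp_le zero_le_dist zero_le_power2)
    then show "p \<in> \<Omega> \<and> (\<forall>q\<in>\<Omega>. dist u p \<le> dist u q)" using p by blast
    fix p' assume p': "p' \<in> \<Omega> \<and> (\<forall>q\<in>\<Omega>. dist u p' \<le> dist u q)"
    then have "(dist u p')\<^sup>2 \<le> (dist u p)\<^sup>2" using p by (intro power_mono) auto
    then have "(dist p p')\<^sup>2 \<le> 0" using dist_p[OF conjunct1[OF p']] by linarith
    then show "p' = p" by simp
  qed
  then show "proj \<Omega> u \<in> \<Omega>" "\<And>q. q \<in> \<Omega> \<Longrightarrow> 0 \<le> (proj \<Omega> u - u) \<bullet> (q - proj \<Omega> u)"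
    using p inn by auto
qed

lemma norm_proj_le:
  fixes \<Omega> :: "'a::{real_inner,complete_space} set"
  assumes "\<Omega> \<noteq> {}" "closed \<Omega>" "convex \<Omega>" "q \<in> \<Omega>"
  shows "norm (proj \<Omega> u - q) \<le> norm (u - q)"
proof -
  have "(norm (proj \<Omega> u - q))\<^sup>2 \<le> (norm (u - q))\<^sup>2 - (norm (proj \<Omega> u - u))\<^sup>2"
    using proj_mem_inner(2)[OF assms(1-3), of q u] assms(4)
    by (simp add: power2_norm_eq_inner inner_simps inner_commute algebra_simps)
  then show ?thesis
    by (smt (verit) norm_ge_zero power2_le_imp_le zero_le_power2)
qed

lemma proj_id:
  fixes \<Omega> :: "'a::{real_inner,complete_space} set"
  assumes "\<Omega> \<noteq> {}" "closed \<Omega>" "convex \<Omega>" "q \<in> \<Omega>"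
  shows "proj \<Omega> q = q"
  using norm_proj_le[OF assms, of q] by simp

text \<open>Allows \<open>F\<close> to be evaluated at a stale point \<open>u\<close> while being
  tested at \<open>x\<close>. Cocoercivity between \<open>u\<close> and \<open>q\<close> yields
  \<open>\<eta> * t\<^sup>2\<close>, the shift costs at most \<open>s * t\<close>, and completing
  the square leaves the loss that appears as \<open>out_eps\<close>.\<close>

lemma cocoercive_shift:
  assumes "cocoercive \<eta> F" "0 < \<eta>"
  shows "- ((norm (u - x))\<^sup>2 / (4 * \<eta>)) \<le> (x - q) \<bullet> (F u - F q)"
proof -
  define s t where "s = norm (u - x)" and "t = norm (F u - F q)"
  have "\<eta> * t\<^sup>2 \<le> (F u - F q) \<bullet> (u - q)" using assms by (simp add: cocoercive_def t_def)
  moreover have "(u - x) \<bullet> (F u - F q) \<le> s * t" unfolding s_def t_def by (rule norm_cauchy_schwarz)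
  moreover have "0 \<le> (2 * \<eta> * t - s)\<^sup>2 / (4 * \<eta>)" using assms by simp
  moreover have "(2 * \<eta> * t - s)\<^sup>2 / (4 * \<eta>) = \<eta> * t\<^sup>2 - s * t + s\<^sup>2 / (4 * \<eta>)"
    using assms by (simp add: field_simps power2_eq_square)
  ultimately show ?thesis
    unfolding s_def[symmetric] by (simp add: inner_simps inner_commute algebra_simps)
qed

lemma cocoercive_forward_nonexpansive:
  assumes "cocoercive \<eta> F" "0 \<le> \<gamma>" "\<gamma> \<le> 2 * \<eta>"
  shows "norm ((u - \<gamma> *\<^sub>R F u) - (v - \<gamma> *\<^sub>R F v)) \<le> norm (u - v)"
proof -
  have "\<gamma> * \<gamma> * (norm (F u - F v))\<^sup>2 \<le> \<gamma> * (2 * \<eta>) * (norm (F u - F v))\<^sup>2"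
    using assms by (intro mult_right_mono mult_left_mono) auto
  also have "\<dots> \<le> 2 * \<gamma> * ((F u - F v) \<bullet> (u - v))"
    using assms mult_left_mono[of "\<eta> * (norm (F u - F v))\<^sup>2" "(F u - F v) \<bullet> (u - v)" "2 * \<gamma>"]
    by (simp add: cocoercive_def algebra_simps)
  finally have "(norm ((u - \<gamma> *\<^sub>R F u) - (v - \<gamma> *\<^sub>R F v)))\<^sup>2 \<le> (norm (u - v))\<^sup>2"
    by (simp add: power2_norm_eq_inner inner_simps inner_commute algebra_simps)
  then show ?thesis by (rule power2_le_imp_le) simp
qed

section \<open>Linear convergence of the inner loop\<close>

lemma log_plus_nonneg: "0 \<le> log_plus t"
  by (simp add: log_plus_def)

lemma le_exp_log_plus: "t \<le> exp (log_plus t)"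
proof (cases "t \<le> 0")
  case True
  then show ?thesis using exp_gt_zero[of "log_plus t"] by linarith
next
  case False
  then have "exp (ln t) \<le> exp (log_plus t)" by (simp only: exp_le_cancel_iff) (simp add: log_plus_def)
  with False show ?thesis by simp
qed

text \<open>Bounding \<alpha> by \<open>exp (\<alpha> - 1)\<close> instead of taking its logarithm
  covers \<alpha> = 0 and produces \<open>1 - \<alpha>\<close> as the decay exponent.\<close>

lemma geometric_decay:
  fixes \<alpha> V :: real
  assumes "0 \<le> \<alpha>" "\<alpha> < 1" "log_plus V / (1 - \<alpha>) \<le> real n"
  shows "\<alpha> ^ n * V \<le> 1"
proof -
  have "\<alpha> \<le> exp (\<alpha> - 1)" using exp_ge_add_one_self[of "\<alpha> - 1"] by simp
  then have "\<alpha> ^ n \<le> exp (real n * (\<alpha> - 1))"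
    using assms power_mono by (fastforce simp: exp_of_nat_mult)
  then have "\<alpha> ^ n * V \<le> exp (real n * (\<alpha> - 1)) * exp (log_plus V)"
    using le_exp_log_plus assms by (meson exp_ge_zero mult_left_mono mult_right_mono order_trans zero_le_power)
  also have "\<dots> = exp (log_plus V - real n * (1 - \<alpha>))"
    by (simp add: exp_add[symmetric] algebra_simps)
  also have "\<dots> \<le> 1" using assms by (simp add: field_simps)
  finally show ?thesis .
qed

locale drt_convergence = drt_splitting A C D1 F1 F2 \<Omega> \<eta> \<sigma> \<theta> \<gamma> z0 \<tau>0
  for A C :: "'a::{real_inner,complete_space} \<Rightarrow> 'a set"
    and D1 :: "'a set" and F1 F2 :: "'a \<Rightarrow> 'a" and \<Omega> :: "'a set"
    and \<eta> \<sigma> \<theta> \<gamma> :: real and z0 :: 'a and \<tau>0 :: real +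
  fixes L M :: real
  assumes A: "maximal_monotone A" and C: "maximal_monotone C"
    and \<Omega>: "\<Omega> \<noteq> {}" "closed \<Omega>" "convex \<Omega>"
    and C_dom: "op_dom C \<subseteq> \<Omega>" and \<Omega>_D1: "\<Omega> \<subseteq> D1"
    and F1_mono: "\<And>z z'. z \<in> \<Omega> \<Longrightarrow> z' \<in> \<Omega> \<Longrightarrow> 0 \<le> (z - z') \<bullet> (F1 z - F1 z')"
    and F1_lip: "L-lipschitz_on \<Omega> F1"
    and \<eta>: "0 < \<eta>" and F2: "cocoercive \<eta> F2"
    and \<tau>0: "0 < \<tau>0" and \<sigma>: "0 < \<sigma>" "\<sigma> < 1" and \<theta>: "0 < \<theta>" "\<theta> < 1"
    and \<gamma>: "0 < \<gamma>"
    and \<gamma>_le: "\<gamma> \<le> 4 * \<eta> * \<sigma>\<^sup>2 / (1 + sqrt (1 + 16 * L\<^sup>2 * \<eta>\<^sup>2 * \<sigma>\<^sup>2))"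
    and M1: "1 / (1 - \<sigma>) \<le> M" and M2: "1 / \<sigma> \<le> M"
    and zer_B: "zer B \<noteq> {}" and zer_AB: "zer (op_sum A B) \<noteq> {}"
begin

section \<open>Consequences of the parameter bounds\<close>

lemma M_ge_2: "2 \<le> M"
proof (cases "\<sigma> \<le> 1/2")
  case True
  then have "2 \<le> 1 / \<sigma>" using \<sigma> by (simp add: field_simps)
  then show ?thesis using M2 by linarith
next
  case False
  then have "2 \<le> 1 / (1 - \<sigma>)" using \<sigma> by (simp add: field_simps)
  then show ?thesis using M1 by linarith
qed

lemma L_nonneg: "0 \<le> L"
  using F1_lip lipschitz_on_nonneg by blast

text \<open>The upper bound on \<open>\<gamma>\<close> is the positive root of \<open>L\<^sup>2 t\<^sup>2 + t / (2 \<eta>) = \<sigma>\<^sup>2\<close>.\<close>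

lemma gamma_quadratic: "(\<gamma> * L)\<^sup>2 + \<gamma> / (2 * \<eta>) \<le> \<sigma>\<^sup>2"
proof -
  define s where "s = sqrt (1 + 16 * L\<^sup>2 * \<eta>\<^sup>2 * \<sigma>\<^sup>2)"
  define g where "g = 4 * \<eta> * \<sigma>\<^sup>2 / (1 + s)"
  have s: "0 \<le> s" "s\<^sup>2 = 1 + 16 * L\<^sup>2 * \<eta>\<^sup>2 * \<sigma>\<^sup>2" by (auto simp: s_def)
  have "\<gamma> \<le> g" using \<gamma>_le by (simp add: g_def s_def)
  then have "(\<gamma> * L)\<^sup>2 + \<gamma> / (2 * \<eta>) \<le> (g * L)\<^sup>2 + g / (2 * \<eta>)"
    using \<gamma> \<eta> L_nonneg by (intro add_mono power_mono mult_right_mono divide_right_mono) auto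
  also have "\<dots> = \<sigma>\<^sup>2 * (16 * L\<^sup>2 * \<eta>\<^sup>2 * \<sigma>\<^sup>2) / (1 + s)\<^sup>2 + 2 * \<sigma>\<^sup>2 / (1 + s)"
    using \<eta> s(1)
    by (simp add: g_def power_mult_distrib power_divide) (simp add: field_simps power2_eq_square power4_eq_xxxx)
  \<comment> \<open>After this factorization the two fractions add up to
    \<open>\<sigma>\<^sup>2 * ((s - 1) + 2) / (1 + s)\<close>.\<close>
  also have "16 * L\<^sup>2 * \<eta>\<^sup>2 * \<sigma>\<^sup>2 = (s - 1) * (1 + s)"
    using s by (simp add: algebra_simps power2_eq_square)
  also have "\<sigma>\<^sup>2 * ((s - 1) * (1 + s)) / (1 + s)\<^sup>2 + 2 * \<sigma>\<^sup>2 / (1 + s) = \<sigma>\<^sup>2"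
    using s(1) by (simp add: divide_simps power2_eq_square) (simp add: algebra_simps)
  finally show ?thesis .
qed

lemma gamma_L_le: "\<gamma> * L \<le> \<sigma>"
proof -
  have "(\<gamma> * L)\<^sup>2 \<le> \<sigma>\<^sup>2"
    using gamma_quadratic \<gamma> \<eta> by (smt (verit) divide_nonneg_pos)
  then show ?thesis by (rule power2_le_imp_le) (use \<sigma> in simp)
qed

lemma gamma_le_eta: "\<gamma> \<le> 2 * \<eta>"
proof -
  have "\<gamma> / (2 * \<eta>) \<le> \<sigma>\<^sup>2" using gamma_quadratic by (smt (verit) zero_le_power2)
  also have "\<sigma>\<^sup>2 \<le> 1" using \<sigma> by (simp add: power_le_one)
  finally show ?thesis using \<eta> by (simp add: field_simps)
qed

section \<open>Monotonicity of the sum operator \<open>B\<close>\<close>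

lemma B_iff: "v \<in> B x \<longleftrightarrow> (\<exists>c\<in>C x. x \<in> D1 \<and> v = c + F1 x + F2 x)"
  by (auto simp: B_def op_sum_def map_op_def)

lemma C_dom_Omega: "c \<in> C x \<Longrightarrow> x \<in> \<Omega>"
  using C_dom by (auto simp: op_dom_def)

lemma B_I: "c \<in> C x \<Longrightarrow> c + F1 x + F2 x \<in> B x"
  using C_dom_Omega \<Omega>_D1 by (auto simp: B_iff)

lemma C_F1_mono:
  assumes "c \<in> C x" "c' \<in> C x'"
  shows "0 \<le> (x - x') \<bullet> ((c + F1 x) - (c' + F1 x'))"
proof -
  have "0 \<le> (x - x') \<bullet> (c - c')" using C assms by (auto simp: maximal_monotone_def monotone_op_def)
  moreover have "0 \<le> (x - x') \<bullet> (F1 x - F1 x')" using assms by (intro F1_mono C_dom_Omega)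
  ultimately show ?thesis by (simp add: inner_simps)
qed

text \<open>\<open>C + F1\<close> is monotone, so the only loss comes from evaluating
  \<open>F2\<close> at \<open>u\<close> instead of \<open>x\<close>: the vector lies in an
  enlargement of \<open>B\<close> at \<open>x\<close>. For \<open>u = x\<close> this is monotonicity
  of \<open>B\<close>.\<close>

lemma B_shifted_mono:
  assumes "c \<in> C x" "v' \<in> B x'"
  shows "- ((norm (u - x))\<^sup>2 / (4 * \<eta>)) \<le> (x - x') \<bullet> (c + F1 x + F2 u - v')"
proof -
  obtain c' where c': "c' \<in> C x'" "v' = c' + F1 x' + F2 x'" using assms by (auto simp: B_iff)
  show ?thesis
    using C_F1_mono[OF assms(1) c'(1)] cocoercive_shift[OF F2 \<eta>, of u x x']
    by (simp add: c'(2) inner_simps)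
qed

section \<open>The forward-backward step and the proximal point of \<open>B\<close>\<close>

lemma fb_step_inclusion:
  obtains c where "c \<in> C (fb_step z u)"
    and "\<gamma> *\<^sub>R c + 2 *\<^sub>R fb_step z u = z + u - \<gamma> *\<^sub>R (F1 (proj \<Omega> u) + F2 (proj \<Omega> u))"
proof -
  define r where "r = z + u - \<gamma> *\<^sub>R (F1 (proj \<Omega> u) + F2 (proj \<Omega> u))"
  have fb: "fb_step z u = resolvent (\<gamma> / 2) C (r /\<^sub>R 2)" by (simp add: fb_step_def r_def)
  have "0 < \<gamma> / 2" using \<gamma> by simp
  then obtain c where c: "c \<in> C (fb_step z u)" "(\<gamma> / 2) *\<^sub>R c + fb_step z u = r /\<^sub>R 2"
    using resolvent_mem[OF C] unfolding fb by metis
  have "\<gamma> *\<^sub>R c + 2 *\<^sub>R fb_step z u = 2 *\<^sub>R ((\<gamma> / 2) *\<^sub>R c + fb_step z u)"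
    by (simp add: scaleR_add_right)
  also have "\<dots> = r" by (simp add: c)
  finally show thesis using that c unfolding r_def by blast
qed

lemma fb_step_Omega: "fb_step z u \<in> \<Omega>"
  by (rule fb_step_inclusion[of z u]) (rule C_dom_Omega)

text \<open>On \<Omega> the projection is the identity. The map \<open>u - \<gamma> F2 u\<close> is
  nonexpansive, \<open>\<gamma> F1\<close> is \<sigma>-Lipschitz, and averaging with
  \<open>z\<close> contributes the factor 1/2.\<close>

lemma fb_step_contraction:
  assumes "u \<in> \<Omega>" "v \<in> \<Omega>"
  shows "norm (fb_step z u - fb_step z v) \<le> (1 + \<sigma>) / 2 * norm (u - v)"
proof -
  define r where "r = (\<lambda>u. z + u - \<gamma> *\<^sub>R (F1 u + F2 u))"
  have pr: "proj \<Omega> u = u" "proj \<Omega> v = v" using assms \<Omega> by (auto intro: proj_id)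
  obtain c where c: "c \<in> C (fb_step z u)" "\<gamma> *\<^sub>R c + 2 *\<^sub>R fb_step z u = r u"
    using fb_step_inclusion[of z u] unfolding pr r_def by blast
  obtain d where d: "d \<in> C (fb_step z v)" "\<gamma> *\<^sub>R d + 2 *\<^sub>R fb_step z v = r v"
    using fb_step_inclusion[of z v] unfolding pr r_def by blast
  have half: "(\<gamma> / 2) *\<^sub>R c + fb_step z u = r u /\<^sub>R 2" "(\<gamma> / 2) *\<^sub>R d + fb_step z v = r v /\<^sub>R 2"
    by (simp_all add: c(2)[symmetric] d(2)[symmetric] scaleR_add_right)
  have "norm (fb_step z u - fb_step z v) \<le> norm (r u /\<^sub>R 2 - r v /\<^sub>R 2)"
    using resolvent_nonexpansive[of C "\<gamma> / 2" c "fb_step z u" d "fb_step z v"] c(1) d(1) C \<gamma>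
    unfolding half by (auto simp: maximal_monotone_def)
  also have "r u /\<^sub>R 2 - r v /\<^sub>R 2 =
      (((u - \<gamma> *\<^sub>R F2 u) - (v - \<gamma> *\<^sub>R F2 v)) - \<gamma> *\<^sub>R (F1 u - F1 v)) /\<^sub>R 2"
    by (simp add: r_def algebra_simps)
  also have "norm \<dots> = norm (((u - \<gamma> *\<^sub>R F2 u) - (v - \<gamma> *\<^sub>R F2 v)) - \<gamma> *\<^sub>R (F1 u - F1 v)) / 2"
    by simp
  also have "\<dots> \<le> (norm ((u - \<gamma> *\<^sub>R F2 u) - (v - \<gamma> *\<^sub>R F2 v)) + norm (\<gamma> *\<^sub>R (F1 u - F1 v))) / 2"
    by (intro divide_right_mono norm_triangle_ineq4) simp
  also have "\<dots> \<le> (norm (u - v) + \<sigma> * norm (u - v)) / 2"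
  proof (intro divide_right_mono add_mono)
    show "norm ((u - \<gamma> *\<^sub>R F2 u) - (v - \<gamma> *\<^sub>R F2 v)) \<le> norm (u - v)"
      using F2 \<gamma> gamma_le_eta by (intro cocoercive_forward_nonexpansive) auto
    have "norm (\<gamma> *\<^sub>R (F1 u - F1 v)) \<le> \<gamma> * (L * norm (u - v))"
      using lipschitz_on_normD[OF F1_lip assms] \<gamma> by simp
    also have "\<dots> \<le> \<sigma> * norm (u - v)"
      using mult_right_mono[OF gamma_L_le norm_ge_zero[of "u - v"]] by (simp add: mult.assoc)
    finally show "norm (\<gamma> *\<^sub>R (F1 u - F1 v)) \<le> \<sigma> * norm (u - v)" .
  qed simp
  also have "\<dots> = (1 + \<sigma>) / 2 * norm (u - v)" by (simp add: algebra_simps)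
  finally show ?thesis .
qed

text \<open>As the forward-backward step is a contraction on \<open>\<Omega>\<close>, the proximal point of \<open>B\<close> exists
  without appealing to the maximality of \<open>B\<close>.\<close>

lemma prox_point:
  obtains p c where "c \<in> C p" "\<gamma> *\<^sub>R (c + F1 p + F2 p) + p = z"
proof -
  have "\<exists>!p\<in>\<Omega>. fb_step z p = p"
  proof (rule Banach_fix)
    show "complete \<Omega>" using \<Omega> by (simp add: complete_eq_closed)
    show "0 \<le> (1 + \<sigma>) / 2" "(1 + \<sigma>) / 2 < 1" using \<sigma> by auto
  qed (use \<Omega> fb_step_Omega fb_step_contraction in \<open>auto simp: dist_norm\<close>)
  then obtain p where p: "p \<in> \<Omega>" "fb_step z p = p" by blast
  obtain c where c: "c \<in> C p" "\<gamma> *\<^sub>R c + 2 *\<^sub>R p = z + p - \<gamma> *\<^sub>R (F1 p + F2 p)"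
    using fb_step_inclusion[of z p] p proj_id[OF \<Omega> p(1)] by auto
  then have "\<gamma> *\<^sub>R (c + F1 p + F2 p) + p = z"
    by (simp add: algebra_simps scaleR_2)
  with c(1) show thesis by (rule that)
qed

text \<open>Monotonicity of \<open>B\<close> between \<open>p\<close> and a zero \<open>q\<close>
  gives a nonnegative inner product of \<open>p - q\<close> and \<open>z - p\<close>; Pythagoras
  does the rest.\<close>

lemma prox_point_closest:
  assumes "c \<in> C p" "\<gamma> *\<^sub>R (c + F1 p + F2 p) + p = z" "q \<in> zer B"
  shows "norm (z - p) \<le> norm (z - q)"
proof -
  have "0 \<in> B q" using assms by (simp add: zer_def)
  then have "0 \<le> (p - q) \<bullet> (c + F1 p + F2 p)" using B_shifted_mono[OF assms(1), of 0 q p] by simp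
  then have "0 \<le> (p - q) \<bullet> (\<gamma> *\<^sub>R (c + F1 p + F2 p))" using \<gamma> by simp
  also have "\<gamma> *\<^sub>R (c + F1 p + F2 p) = z - p" using assms(2) by (simp add: eq_diff_eq)
  finally have "0 \<le> (p - q) \<bullet> (z - p)" .
  then have "(norm (z - p))\<^sup>2 + (norm (p - q))\<^sup>2 \<le> (norm (z - q))\<^sup>2"
    by (simp add: power2_norm_eq_inner inner_simps inner_commute algebra_simps)
  then show ?thesis by (smt (verit) norm_ge_zero power2_le_imp_le zero_le_power2)
qed

text \<open>Tseng's correction moves the evaluation of \<open>F1\<close> from \<open>w'\<close> to
  the new point, so that only \<open>F2\<close> stays at the stale point and
  \<open>B_shifted_mono\<close> applies.\<close>

lemma inner_step_inclusion:
  obtains c where "c \<in> C (fb_step z (w z j))"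
    and "z + w z j - (w z (Suc j) + fb_step z (w z j)) =
      \<gamma> *\<^sub>R (c + F1 (fb_step z (w z j)) + F2 (w' z j))"
proof -
  obtain c where c: "c \<in> C (fb_step z (w z j))"
    "\<gamma> *\<^sub>R c + 2 *\<^sub>R fb_step z (w z j) = z + w z j - \<gamma> *\<^sub>R (F1 (w' z j) + F2 (w' z j))"
    using fb_step_inclusion unfolding w'_def by blast
  have "z + w z j - (w z (Suc j) + fb_step z (w z j)) =
      (z + w z j - \<gamma> *\<^sub>R (F1 (w' z j) + F2 (w' z j))) - 2 *\<^sub>R fb_step z (w z j)
      + \<gamma> *\<^sub>R (F1 (fb_step z (w z j)) + F2 (w' z j))"
    by (simp add: w'_def scaleR_2 algebra_simps)
  also have "\<dots> = \<gamma> *\<^sub>R (c + F1 (fb_step z (w z j)) + F2 (w' z j))"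
    unfolding c(2)[symmetric] by (simp add: algebra_simps)
  finally show thesis using c(1) that by blast
qed

lemma forward_correction_le:
  "norm (w z (Suc j) - fb_step z (w z j)) \<le> \<gamma> * L * norm (w' z j - fb_step z (w z j))"
proof -
  have "norm (F1 (fb_step z (w z j)) - F1 (w' z j)) \<le> L * norm (w' z j - fb_step z (w z j))"
    using lipschitz_on_normD[OF F1_lip fb_step_Omega, of "w' z j" z "w z j"] proj_mem_inner(1)[OF \<Omega>]
    by (simp add: w'_def norm_minus_commute)
  then show ?thesis using \<gamma> by (simp add: w'_def mult.assoc)
qed

text \<open>The inclusions at the forward-backward point and at \<open>p\<close> are compared; the
  identity part of \<open>\<gamma> B + I\<close> produces the last term on the left. The cocoercive
  loss and the Tseng correction are both multiples of the same squared distance, with coefficients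
  adding up to the left side of \<open>gamma_quadratic\<close>.\<close>

lemma inner_step_descent:
  assumes "c \<in> C p" "\<gamma> *\<^sub>R (c + F1 p + F2 p) + p = z"
  shows "(norm (w z (Suc j) - p))\<^sup>2 + (1 - \<sigma>\<^sup>2) * (norm (w z j - fb_step z (w z j)))\<^sup>2
    + 2 * (norm (fb_step z (w z j) - p))\<^sup>2 \<le> (norm (w z j - p))\<^sup>2"
proof -
  define u x v u' where "u = w z j" and "x = fb_step z u" and "v = w z (Suc j)" and "u' = w' z j"
  obtain d where d: "d \<in> C x" "z + u - (v + x) = \<gamma> *\<^sub>R (d + F1 x + F2 u')"
    using inner_step_inclusion[of z j] unfolding u_def x_def v_def u'_def by blast
  have p_eq: "\<gamma> *\<^sub>R (c + F1 p + F2 p) = z - p" using assms(2) by (simp add: eq_diff_eq)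
  have u'_le: "norm (u' - x) \<le> norm (u - x)"
    unfolding u'_def w'_def u_def x_def using fb_step_Omega by (intro norm_proj_le \<Omega>)
  have vx: "(norm (v - x))\<^sup>2 \<le> (\<gamma> * L)\<^sup>2 * (norm (u' - x))\<^sup>2"
    using power_mono[OF forward_correction_le[of z j], of 2]
    by (simp add: power_mult_distrib u_def x_def v_def u'_def)
  have "- (\<gamma> * ((norm (u' - x))\<^sup>2 / (4 * \<eta>))) \<le> \<gamma> * ((x - p) \<bullet> (d + F1 x + F2 u' - (c + F1 p + F2 p)))"
    using B_shifted_mono[OF d(1) B_I[OF assms(1)], of u'] \<gamma>
    by (metis mult_le_cancel_left_pos mult_minus_right)
  also have "\<dots> = (x - p) \<bullet> (\<gamma> *\<^sub>R (d + F1 x + F2 u') - \<gamma> *\<^sub>R (c + F1 p + F2 p))"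
    by (simp add: inner_simps right_diff_distrib distrib_left)
  also have "\<gamma> *\<^sub>R (d + F1 x + F2 u') - \<gamma> *\<^sub>R (c + F1 p + F2 p) = (u - v) - (x - p)"
    unfolding d(2)[symmetric] p_eq by (simp add: algebra_simps)
  finally have "- (\<gamma> / (2 * \<eta>) * (norm (u' - x))\<^sup>2) + 2 * (norm (x - p))\<^sup>2 \<le> 2 * ((x - p) \<bullet> (u - v))"
    by (simp add: inner_diff_right power2_norm_eq_inner)
  moreover have "(norm (u - p))\<^sup>2 - (norm (v - p))\<^sup>2 =
      2 * ((x - p) \<bullet> (u - v)) + (norm (u - x))\<^sup>2 - (norm (v - x))\<^sup>2"
    by (simp add: power2_norm_eq_inner inner_simps inner_commute algebra_simps)
  moreover have "((\<gamma> * L)\<^sup>2 + \<gamma> / (2 * \<eta>)) * (norm (u' - x))\<^sup>2 \<le> \<sigma>\<^sup>2 * (norm (u - x))\<^sup>2"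
    using gamma_quadratic u'_le by (intro mult_mono power_mono) auto
  ultimately have "(norm (v - p))\<^sup>2 + (1 - \<sigma>\<^sup>2) * (norm (u - x))\<^sup>2 + 2 * (norm (x - p))\<^sup>2
      \<le> (norm (u - p))\<^sup>2"
    using vx by (simp add: algebra_simps)
  then show ?thesis by (simp add: u_def x_def v_def)
qed

section \<open>Convergence rate and termination of the inner loop\<close>

lemma sigma_sq_less: "\<sigma>\<^sup>2 < 1"
  using \<sigma> by (simp add: power_less_one_iff)

lemma inverse_one_minus_sigma_sq: "1 / (1 - \<sigma>\<^sup>2) \<le> M"
proof -
  have "\<sigma>\<^sup>2 \<le> \<sigma> * 1" unfolding power2_eq_square using \<sigma> by (intro mult_left_mono) auto
  then have "1 / (1 - \<sigma>\<^sup>2) \<le> 1 / (1 - \<sigma>)" using \<sigma> sigma_sq_less by (intro divide_left_mono) auto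
  then show ?thesis using M1 by linarith
qed

text \<open>With \<open>q = 1 - \<sigma>\<^sup>2\<close> this is \<open>(2 - q) / (2 + q)\<close>,
  the factor left after minimizing the decrease \<open>q * a\<^sup>2 + 2 * b\<^sup>2\<close> for
  fixed \<open>a + b\<close>.\<close>

definition rate :: real where "rate = (1 + \<sigma>\<^sup>2) / (3 - \<sigma>\<^sup>2)"

lemma rate: "0 \<le> rate" "rate < 1" "1 / (1 - rate) \<le> M + 1/2"
proof -
  have D: "0 < 1 - \<sigma>\<^sup>2" "0 < 3 - \<sigma>\<^sup>2" using sigma_sq_less by auto
  then show "0 \<le> rate" "rate < 1" by (auto simp: rate_def field_simps)
  have "1 - rate = 2 * (1 - \<sigma>\<^sup>2) / (3 - \<sigma>\<^sup>2)" using D by (simp add: rate_def field_simps)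
  then have "1 / (1 - rate) = (3 - \<sigma>\<^sup>2) / (2 * (1 - \<sigma>\<^sup>2))" by simp
  also have "\<dots> = 1 / (1 - \<sigma>\<^sup>2) + 1/2" using D by (simp add: field_simps)
  finally show "1 / (1 - rate) \<le> M + 1/2" using inverse_one_minus_sigma_sq by linarith
qed

lemma inner_step_contraction:
  assumes "c \<in> C p" "\<gamma> *\<^sub>R (c + F1 p + F2 p) + p = z"
  shows "(norm (w z (Suc j) - p))\<^sup>2 \<le> rate * (norm (w z j - p))\<^sup>2"
proof -
  define a b where "a = norm (w z j - fb_step z (w z j))" and "b = norm (fb_step z (w z j) - p)"
  define q where "q = 1 - \<sigma>\<^sup>2"
  have q: "0 < q" using sigma_sq_less by (simp add: q_def)
  have "norm (w z j - p) \<le> a + b"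
    using norm_triangle_ineq[of "w z j - fb_step z (w z j)" "fb_step z (w z j) - p"]
    by (simp add: a_def b_def)
  then have "2 * q * (norm (w z j - p))\<^sup>2 \<le> 2 * q * (a + b)\<^sup>2"
    using q by (intro mult_left_mono power_mono) auto
  \<comment> \<open>The difference of the two sides is exactly
    \<open>(q * a - 2 * b)\<^sup>2\<close>.\<close>
  also have "\<dots> \<le> (2 + q) * (q * a\<^sup>2 + 2 * b\<^sup>2)"
  proof -
    have "0 \<le> (q * a - 2 * b)\<^sup>2" by simp
    then show ?thesis by (simp add: power2_eq_square algebra_simps)
  qed
  also have "\<dots> \<le> (2 + q) * ((norm (w z j - p))\<^sup>2 - (norm (w z (Suc j) - p))\<^sup>2)"
    using inner_step_descent[OF assms, of j] q
    by (intro mult_left_mono) (auto simp: a_def b_def q_def)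
  finally have "(2 + q) * (norm (w z (Suc j) - p))\<^sup>2 \<le> (2 - q) * (norm (w z j - p))\<^sup>2"
    by (simp add: algebra_simps del: w.simps)
  also have "2 - q = (2 + q) * rate"
    using q by (simp add: rate_def q_def)
  finally show ?thesis using q by (simp only: mult.assoc mult_le_cancel_left_pos)
qed

lemma w_linear_convergence:
  assumes "c \<in> C p" "\<gamma> *\<^sub>R (c + F1 p + F2 p) + p = z"
  shows "(norm (w z j - p))\<^sup>2 \<le> rate ^ j * (norm (z - p))\<^sup>2"
proof (induction j)
  case (Suc j)
  have "(norm (w z (Suc j) - p))\<^sup>2 \<le> rate * (norm (w z j - p))\<^sup>2"
    by (rule inner_step_contraction[OF assms])
  also have "\<dots> \<le> rate * (rate ^ j * (norm (z - p))\<^sup>2)"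
    by (rule mult_left_mono[OF Suc rate(1)])
  finally show ?case by (simp add: mult.assoc)
qed simp

text \<open>With \<open>s\<close> the length of the forward-backward move, the residual is at most
  \<open>(1 + \<sigma>)\<^sup>2 * s\<^sup>2\<close>, while the descent inequality bounds
  \<open>(1 - \<sigma>\<^sup>2) * s\<^sup>2\<close>. The quotient
  \<open>(1 + \<sigma>) / (1 - \<sigma>)\<close> is at most \<open>2 * M\<close>.\<close>

lemma inner_residual_le:
  assumes "c \<in> C p" "\<gamma> *\<^sub>R (c + F1 p + F2 p) + p = z"
  shows "(norm (w z j - w z (Suc j)))\<^sup>2 + \<gamma> * (norm (w' z j - wt z (Suc j)))\<^sup>2 / (2 * \<eta>)
    \<le> 2 * M * (norm (w z j - p))\<^sup>2"
proof -
  define x s where "x = fb_step z (w z j)" and "s = norm (w z j - x)"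
  have le: "norm (w' z j - x) \<le> s"
    unfolding s_def w'_def x_def using fb_step_Omega by (intro norm_proj_le \<Omega>)
  have gL: "0 \<le> \<gamma> * L" using \<gamma> L_nonneg by simp
  have "norm (w z (Suc j) - x) \<le> \<gamma> * L * norm (w' z j - x)"
    using forward_correction_le[of z j] by (simp add: x_def)
  also have "\<dots> \<le> \<gamma> * L * s" by (rule mult_left_mono[OF le gL])
  finally have "norm (w z j - w z (Suc j)) \<le> s + \<gamma> * L * s"
    using norm_triangle_ineq4[of "w z j - x" "w z (Suc j) - x"] by (simp add: s_def)
  then have "(norm (w z j - w z (Suc j)))\<^sup>2 \<le> (s + \<gamma> * L * s)\<^sup>2" by (rule power_mono) simp
  moreover have "\<gamma> * (norm (w' z j - x))\<^sup>2 / (2 * \<eta>) \<le> \<gamma> / (2 * \<eta>) * s\<^sup>2"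
    using power_mono[OF le, of 2] \<gamma> \<eta> by (simp add: divide_right_mono)
  ultimately have "(norm (w z j - w z (Suc j)))\<^sup>2 + \<gamma> * (norm (w' z j - x))\<^sup>2 / (2 * \<eta>)
      \<le> (1 + 2 * (\<gamma> * L) + ((\<gamma> * L)\<^sup>2 + \<gamma> / (2 * \<eta>))) * s\<^sup>2"
    by (simp add: power2_eq_square algebra_simps)
  also have "\<dots> \<le> (1 + 2 * \<sigma> + \<sigma>\<^sup>2) * s\<^sup>2"
    using gamma_L_le gamma_quadratic by (intro mult_right_mono add_mono) auto
  also have "\<dots> = (1 + \<sigma>) / (1 - \<sigma>) * ((1 - \<sigma>\<^sup>2) * s\<^sup>2)"
    using \<sigma> by (simp add: field_simps power2_eq_square power4_eq_xxxx)
  also have "\<dots> \<le> (2 * M) * (norm (w z j - p))\<^sup>2"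
  proof (rule mult_mono)
    have "(1 + \<sigma>) * (1 / (1 - \<sigma>)) \<le> 2 * M" using \<sigma> M1 by (intro mult_mono) auto
    then show "(1 + \<sigma>) / (1 - \<sigma>) \<le> 2 * M" by simp
    show "(1 - \<sigma>\<^sup>2) * s\<^sup>2 \<le> (norm (w z j - p))\<^sup>2"
      using inner_step_descent[OF assms, of j] unfolding s_def x_def
      by (smt (verit) zero_le_power2)
  qed (use M_ge_2 sigma_sq_less in auto)
  finally show ?thesis by (simp add: wt_def x_def)
qed

lemma inner_loop_terminates:
  assumes "0 < \<tau>"
  obtains p j where "\<And>q. q \<in> zer B \<Longrightarrow> norm (z - p) \<le> norm (z - q)"
    and "inner_stop z \<tau> j"
    and "real j \<le> 2 + (M + 1/2) * log_plus (2 * M * (norm (z - p))\<^sup>2 / \<tau>)"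
proof -
  obtain p c where p: "c \<in> C p" "\<gamma> *\<^sub>R (c + F1 p + F2 p) + p = z" by (rule prox_point)
  \<comment> \<open>\<open>V\<close> is the initial bound on the residual relative to \<tau>; the
    test succeeds once \<open>rate ^ n * V\<close> is at most 1.\<close>
  define V where "V = 2 * M * (norm (z - p))\<^sup>2 / \<tau>"
  define n where "n = nat \<lceil>log_plus V / (1 - rate)\<rceil>"
  have nonneg: "0 \<le> log_plus V / (1 - rate)" using log_plus_nonneg rate by simp
  then have n: "log_plus V / (1 - rate) \<le> real n" "real n \<le> log_plus V / (1 - rate) + 1"
    unfolding n_def by linarith+
  have "2 * M * (norm (w z n - p))\<^sup>2 \<le> 2 * M * (rate ^ n * (norm (z - p))\<^sup>2)"
    using M_ge_2 w_linear_convergence[OF p, of n] by (intro mult_left_mono) auto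
  also have "\<dots> = \<tau> * (rate ^ n * V)" using assms by (simp add: V_def)
  also have "\<dots> \<le> \<tau> * 1"
    using geometric_decay[OF rate(1,2) n(1)] assms by (intro mult_left_mono) auto
  \<comment> \<open>The residual at \<open>w z n\<close> is tested in iteration
    \<open>Suc n\<close>; this shift and the ceiling in \<open>n\<close> account for the constant
    2.\<close>
  finally have "inner_stop z \<tau> (Suc n)"
    using inner_residual_le[OF p, of n] by (simp add: inner_stop_def)
  moreover have "log_plus V / (1 - rate) \<le> (M + 1/2) * log_plus V"
    using mult_right_mono[OF rate(3) log_plus_nonneg[of V]] by simp
  with n(2) have "real (Suc n) \<le> 2 + (M + 1/2) * log_plus V" by simp
  ultimately show thesis using that prox_point_closest[OF p] unfolding V_def by blast
qed

end

section \<open>Averages and covariances\<close>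

definition avg :: "'i set \<Rightarrow> ('i \<Rightarrow> 'v::real_vector) \<Rightarrow> 'v" where
  "avg I u = (\<Sum>i\<in>I. u i) /\<^sub>R real (card I)"

text \<open>The sum is not divided by the cardinality; that division happens in
  \<open>erg_eps_a_eq\<close> and \<open>erg_eps_b_eq\<close>.\<close>

definition cov :: "'i set \<Rightarrow> ('i \<Rightarrow> 'v::real_inner) \<Rightarrow> ('i \<Rightarrow> 'v) \<Rightarrow> real" where
  "cov I u v = (\<Sum>i\<in>I. (u i - avg I u) \<bullet> (v i - avg I v))"

lemma sum_eq_avg:
  assumes "finite I" "I \<noteq> {}"
  shows "(\<Sum>i\<in>I. u i) = real (card I) *\<^sub>R avg I u"
  using assms by (simp add: avg_def)

lemma avg_add: "avg I (\<lambda>i. u i + v i) = avg I u + avg I v"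
  by (simp add: avg_def sum.distrib scaleR_add_right)

lemma avg_diff: "avg I (\<lambda>i. u i - v i) = avg I u - avg I v"
  by (simp add: avg_def sum_subtractf scaleR_diff_right)

lemma avg_scaleR: "avg I (\<lambda>i. c *\<^sub>R u i) = c *\<^sub>R avg I u"
  by (simp add: avg_def scaleR_sum_right[symmetric])

text \<open>Parallel-axis identity: the cross terms vanish because deviations from the mean sum to
  zero.\<close>

lemma cov_shift:
  assumes "finite I" "I \<noteq> {}"
  shows "(\<Sum>i\<in>I. (u i - q) \<bullet> (v i - r)) =
    cov I u v + real (card I) * ((avg I u - q) \<bullet> (avg I v - r))"
proof -
  have zero: "(\<Sum>i\<in>I. u i - avg I u) = 0" "(\<Sum>i\<in>I. v i - avg I v) = 0"
    by (simp_all add: sum_subtractf sum_eq_avg[OF assms] sum_constant_scaleR)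
  have "(\<Sum>i\<in>I. (u i - q) \<bullet> (v i - r)) =
      (\<Sum>i\<in>I. (u i - avg I u) \<bullet> (v i - avg I v) + (u i - avg I u) \<bullet> (avg I v - r)
        + (avg I u - q) \<bullet> (v i - avg I v) + (avg I u - q) \<bullet> (avg I v - r))"
    by (intro sum.cong) (simp_all add: inner_simps)
  also have "\<dots> = cov I u v + (\<Sum>i\<in>I. u i - avg I u) \<bullet> (avg I v - r)
      + (avg I u - q) \<bullet> (\<Sum>i\<in>I. v i - avg I v) + real (card I) * ((avg I u - q) \<bullet> (avg I v - r))"
    by (simp add: sum.distrib cov_def inner_sum_left inner_sum_right)
  finally show ?thesis by (simp add: zero)
qed

lemma cov_eq_sum:
  assumes "finite I" "I \<noteq> {}"
  shows "cov I u v = (\<Sum>i\<in>I. (u i - avg I u) \<bullet> v i)"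
  using cov_shift[OF assms, of u "avg I u" v 0] by simp

lemma cov_add_right: "cov I u (\<lambda>i. v i + v' i) = cov I u v + cov I u v'"
  by (simp add: cov_def avg_add sum.distrib[symmetric] inner_simps algebra_simps)

text \<open>By \<open>cov_shift\<close>, the double sum of the pairwise products equals twice the
  cardinality times the covariance.\<close>

lemma cov_nonneg:
  assumes "finite I" "I \<noteq> {}"
    and mono: "\<And>i j. i \<in> I \<Longrightarrow> j \<in> I \<Longrightarrow> 0 \<le> (u i - u j) \<bullet> (v i - v j)"
  shows "0 \<le> cov I u v"
proof -
  have "0 \<le> (\<Sum>j\<in>I. \<Sum>i\<in>I. (u i - u j) \<bullet> (v i - v j))"
    by (intro sum_nonneg mono)
  also have "\<dots> = real (card I) * cov I u v
      + real (card I) * (\<Sum>j\<in>I. (avg I u - u j) \<bullet> (avg I v - v j))"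
    by (simp add: cov_shift[OF assms(1,2)] sum.distrib sum_distrib_left)
  also have "(\<Sum>j\<in>I. (avg I u - u j) \<bullet> (avg I v - v j)) = cov I u v"
    unfolding cov_def by (intro sum.cong) (simp_all add: inner_simps)
  finally show ?thesis using assms(1,2) by (simp add: zero_le_mult_iff card_gt_0_iff)
qed

lemma norm_avg_diff_le:
  assumes "finite I" "I \<noteq> {}" "\<And>i. i \<in> I \<Longrightarrow> norm (u i - q) \<le> r"
  shows "norm (avg I u - q) \<le> r"
proof -
  have "real (card I) *\<^sub>R (avg I u - q) = (\<Sum>i\<in>I. u i - q)"
    using assms by (simp add: sum_eq_avg sum_subtractf scaleR_diff_right sum_constant_scaleR)
  then have "real (card I) * norm (avg I u - q) = norm (\<Sum>i\<in>I. u i - q)"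
    by (metis abs_of_nat norm_scaleR)
  also have "\<dots> \<le> real (card I) * r"
    using assms by (intro sum_norm_bound)
  finally show ?thesis using assms by (simp add: card_gt_0_iff)
qed

lemma le_infdist:
  assumes "S \<noteq> {}" "\<And>s. s \<in> S \<Longrightarrow> t \<le> dist a s"
  shows "t \<le> infdist a S"
  using assms by (simp add: infdist_notempty cINF_greatest)

lemma le_infdist_power2:
  assumes "S \<noteq> {}" "\<And>s. s \<in> S \<Longrightarrow> t \<le> (dist a s)\<^sup>2"
  shows "t \<le> (infdist a S)\<^sup>2"
proof -
  have "sqrt t \<le> infdist a S"
    using assms by (intro le_infdist real_le_lsqrt) auto
  then show ?thesis by (rule sqrt_le_D)
qed

section \<open>Fejer monotonicity of the outer iterations\<close>

context drt_convergence
begin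

lemma inner_stop_inner_iters: "0 < \<tau> \<Longrightarrow> inner_stop z \<tau> (inner_iters z \<tau>)"
  unfolding inner_iters_def by (rule inner_loop_terminates[of \<tau> z]) (auto intro: LeastI)

text \<open>With these outputs \<open>\<gamma> b + x - z\<close> is the difference of two successive
  inner iterates, so the left side of the relative-error test coincides with the left side of the
  inner stopping test and is bounded by \<tau>.\<close>

lemma outer_step_data:
  assumes "0 < \<tau>"
  obtains c u where "c \<in> C (out_x z \<tau>)" "out_b z \<tau> = c + F1 (out_x z \<tau>) + F2 u"
    "out_eps z \<tau> = (norm (u - out_x z \<tau>))\<^sup>2 / (4 * \<eta>)"
    "(norm (\<gamma> *\<^sub>R out_b z \<tau> + out_x z \<tau> - z))\<^sup>2 + 2 * \<gamma> * out_eps z \<tau> \<le> \<tau>"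
proof -
  have stop: "inner_stop z \<tau> (inner_iters z \<tau>)" using assms by (rule inner_stop_inner_iters)
  then obtain j where j: "inner_iters z \<tau> = Suc j"
    by (cases "inner_iters z \<tau>") (auto simp: inner_stop_def)
  have x: "out_x z \<tau> = fb_step z (w z j)" by (simp add: out_x_def j wt_def)
  obtain c where c: "c \<in> C (out_x z \<tau>)"
    "z + w z j - (w z (Suc j) + out_x z \<tau>) = \<gamma> *\<^sub>R (c + F1 (out_x z \<tau>) + F2 (w' z j))"
    using inner_step_inclusion[of z j] unfolding x by blast
  have eps: "out_eps z \<tau> = (norm (w' z j - out_x z \<tau>))\<^sup>2 / (4 * \<eta>)"
    by (simp add: out_eps_def j x wt_def)
  have "out_b z \<tau> = (z + w z j - (w z (Suc j) + out_x z \<tau>)) /\<^sub>R \<gamma>"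
    by (simp add: out_b_def j x wt_def)
  also have "\<dots> = c + F1 (out_x z \<tau>) + F2 (w' z j)"
    unfolding c(2) using \<gamma> by simp
  finally have b: "out_b z \<tau> = c + F1 (out_x z \<tau>) + F2 (w' z j)" .
  have "\<gamma> *\<^sub>R out_b z \<tau> + out_x z \<tau> - z = w z j - w z (Suc j)"
    unfolding b c(2)[symmetric] by (simp add: algebra_simps del: w.simps)
  moreover have "2 * \<gamma> * out_eps z \<tau> = \<gamma> * (norm (w' z j - out_x z \<tau>))\<^sup>2 / (2 * \<eta>)"
    by (simp add: eps)
  moreover have "(norm (w z j - w z (Suc j)))\<^sup>2 + \<gamma> * (norm (w' z j - out_x z \<tau>))\<^sup>2 / (2 * \<eta>) \<le> \<tau>"
    using stop by (simp add: inner_stop_def j x wt_def del: w.simps)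
  ultimately show thesis by (intro that[OF c(1) b eps]) (simp only:)
qed

lemma A_mono: "a \<in> A y \<Longrightarrow> a' \<in> A y' \<Longrightarrow> 0 \<le> (y - y') \<bullet> (a - a')"
  using A by (auto simp: maximal_monotone_def monotone_op_def)

lemma out_ya:
  "out_a z \<tau> \<in> A (out_y z \<tau>)"
  "\<gamma> *\<^sub>R out_a z \<tau> + out_y z \<tau> = out_x z \<tau> - \<gamma> *\<^sub>R out_b z \<tau>"
proof -
  define r where "r = out_x z \<tau> - \<gamma> *\<^sub>R out_b z \<tau>"
  obtain y a where ya: "a \<in> A y" "\<gamma> *\<^sub>R a + y = r" using minty[OF A \<gamma>] by blast
  have "snd (out_ya z \<tau>) \<in> A (fst (out_ya z \<tau>)) \<and>
      \<gamma> *\<^sub>R snd (out_ya z \<tau>) + fst (out_ya z \<tau>) = r"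
    unfolding out_ya_def r_def[symmetric]
  proof (rule theI)
    show "snd (y, a) \<in> A (fst (y, a)) \<and> \<gamma> *\<^sub>R snd (y, a) + fst (y, a) = r" using ya by simp
    fix ya' assume ya': "snd ya' \<in> A (fst ya') \<and> \<gamma> *\<^sub>R snd ya' + fst ya' = r"
    then have "fst ya' = y"
      using resolvent_nonexpansive[of A \<gamma> "snd ya'" "fst ya'" a y] A \<gamma> ya
      by (auto simp: maximal_monotone_def)
    then have "\<gamma> *\<^sub>R snd ya' + y = \<gamma> *\<^sub>R a + y" using ya' ya by simp
    then have "snd ya' = a" using \<gamma> by simp
    with \<open>fst ya' = y\<close> show "ya' = (y, a)" by (simp add: prod_eq_iff)
  qed
  then show "out_a z \<tau> \<in> A (out_y z \<tau>)"
    "\<gamma> *\<^sub>R out_a z \<tau> + out_y z \<tau> = out_x z \<tau> - \<gamma> *\<^sub>R out_b z \<tau>"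
    by (simp_all add: out_a_def out_y_def r_def)
qed

section \<open>The outer sequences and their relation to \<open>S\<close>\<close>

lemma zs_0: "zs 0 = z0" and taus_0: "\<tau>s 0 = \<tau>0"
  by (simp_all add: zs_def \<tau>s_def)

lemma zs_Suc: "zs (Suc k) = (if extragradient (Suc k) then zs k - \<gamma> *\<^sub>R (as (Suc k) + bs (Suc k)) else zs k)"
  by (simp add: zs_def \<tau>s_def as_def bs_def extragradient_def Let_def)

lemma taus_Suc: "\<tau>s (Suc k) = (if extragradient (Suc k) then \<tau>s k else \<theta> * \<tau>s k)"
  by (simp add: zs_def \<tau>s_def extragradient_def Let_def)

lemma taus_pos: "0 < \<tau>s k"
  by (induction k) (use \<tau>0 \<theta> in \<open>auto simp: taus_0 taus_Suc\<close>)

lemma inner_terminates_always: "inner_terminates k"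
  unfolding inner_terminates_def using inner_stop_inner_iters[OF taus_pos] by blast

lemma as_mem: "as k \<in> A (ys k)"
  by (simp add: as_def ys_def out_ya)

lemma step_eq: "\<gamma> *\<^sub>R (as k + bs k) = xs k - ys k"
  using out_ya(2)[of "zs (k - 1)" "\<tau>s (k - 1)"]
  by (simp add: as_def bs_def xs_def ys_def algebra_simps eq_diff_eq)

lemma bs_decomposition:
  obtains c u where "c \<in> C (xs k)" "bs k = c + F1 (xs k) + F2 u"
    "eps_b k = (norm (u - xs k))\<^sup>2 / (4 * \<eta>)"
  using outer_step_data[OF taus_pos[of "k - 1"], of "zs (k - 1)"]
  unfolding xs_def bs_def eps_b_def by blast

lemma residual_le:
  "(norm (\<gamma> *\<^sub>R bs k + xs k - zs (k - 1)))\<^sup>2 + 2 * \<gamma> * eps_b k \<le> \<tau>s (k - 1)"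
  using outer_step_data[OF taus_pos[of "k - 1"], of "zs (k - 1)"]
  unfolding xs_def bs_def eps_b_def by blast

lemma eps_b_nonneg: "0 \<le> eps_b k"
  by (rule bs_decomposition[of k]) (use \<eta> in simp)

lemma bs_relative:
  assumes "v \<in> B q"
  shows "- eps_b k \<le> (xs k - q) \<bullet> (bs k - v)"
proof -
  obtain c u where cu: "c \<in> C (xs k)" "bs k = c + F1 (xs k) + F2 u"
    "eps_b k = (norm (u - xs k))\<^sup>2 / (4 * \<eta>)" by (rule bs_decomposition)
  show ?thesis unfolding cu(2,3) by (rule B_shifted_mono[OF cu(1) assms])
qed

text \<open>First component of the graph point of \<open>S\<close> produced by step
  \<open>k\<close>, up to the error \<open>eps_b k\<close>; the second component is
  \<open>\<gamma> (as k + bs k)\<close>.\<close>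

definition zeta :: "nat \<Rightarrow> 'a" where "zeta k = ys k + \<gamma> *\<^sub>R bs k"

text \<open>The Douglas-Rachford identity behind the monotonicity of \<open>S\<close>.\<close>

lemma splitting_identity:
  fixes x y a b :: 'a
  assumes "\<gamma> *\<^sub>R (a + b) = x - y"
  shows "(y + \<gamma> *\<^sub>R b) \<bullet> (\<gamma> *\<^sub>R (a + b)) = \<gamma> * (y \<bullet> a + x \<bullet> b)"
proof -
  have "(y + \<gamma> *\<^sub>R b) \<bullet> (\<gamma> *\<^sub>R (a + b)) = \<gamma> * (y \<bullet> (a + b)) + \<gamma> * (b \<bullet> (\<gamma> *\<^sub>R (a + b)))"
    by (simp add: inner_add_left distrib_left)
  also have "\<dots> = \<gamma> * (y \<bullet> a + x \<bullet> b)"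
    unfolding assms by (simp add: inner_simps inner_commute algebra_simps)
  finally show ?thesis .
qed

text \<open>The splitting relation is linear, so \<open>splitting_identity\<close> applies to the
  differences between step \<open>k\<close> and the data representing \<open>p\<close>. Monotonicity
  of \<open>A\<close> and the relaxed monotonicity \<open>bs_relative\<close> then bound its right
  side.\<close>

lemma zer_S_inner:
  assumes "p \<in> zer (S_op \<gamma> A B)"
  shows "- (\<gamma> * eps_b k) \<le> (zeta k - p) \<bullet> (\<gamma> *\<^sub>R (as k + bs k))"
proof -
  obtain x y a b where *: "b \<in> B x" "a \<in> A y" "\<gamma> *\<^sub>R a + y = x - \<gamma> *\<^sub>R b" "p = y + \<gamma> *\<^sub>R b"
    "0 = \<gamma> *\<^sub>R a + \<gamma> *\<^sub>R b"
    using assms by (auto simp: zer_def S_op_def)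
  have ab: "\<gamma> *\<^sub>R (a + b) = x - y" "\<gamma> *\<^sub>R (a + b) = 0"
    using *(3,5) by (simp_all add: scaleR_add_right eq_diff_eq add.commute add.left_commute)
  have diff: "\<gamma> *\<^sub>R ((as k - a) + (bs k - b)) = (xs k - x) - (ys k - y)"
    using step_eq[of k] ab(1) by (simp add: algebra_simps)
  have "- (\<gamma> * eps_b k) \<le> \<gamma> * ((ys k - y) \<bullet> (as k - a) + (xs k - x) \<bullet> (bs k - b))"
    using A_mono[OF as_mem[of k] *(2)] bs_relative[OF *(1), of k]
      mult_left_mono[of "- eps_b k" _ \<gamma>] \<gamma> by simp
  also have "\<dots> = ((ys k - y) + \<gamma> *\<^sub>R (bs k - b)) \<bullet> (\<gamma> *\<^sub>R ((as k - a) + (bs k - b)))"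
    by (rule splitting_identity[OF diff, symmetric])
  also have "(ys k - y) + \<gamma> *\<^sub>R (bs k - b) = zeta k - p"
    by (simp add: zeta_def *(4) algebra_simps)
  also have "\<gamma> *\<^sub>R ((as k - a) + (bs k - b)) = \<gamma> *\<^sub>R (as k + bs k)"
    using ab(2) by (simp add: algebra_simps)
  finally show ?thesis .
qed

text \<open>If \<open>a + b = 0\<close> at a common point \<open>x\<close>, then
  \<open>x + \<gamma> b\<close> is a zero of \<open>S\<close>, with \<open>y = x\<close> in the
  splitting relation.\<close>

lemma zer_S_nonempty: "zer (S_op \<gamma> A B) \<noteq> {}"
proof -
  obtain x a b where x: "a \<in> A x" "b \<in> B x" "a + b = 0"
    using zer_AB by (fastforce simp: zer_def op_sum_def)
  have eq: "\<gamma> *\<^sub>R a + x = x - \<gamma> *\<^sub>R b" "0 = \<gamma> *\<^sub>R a + \<gamma> *\<^sub>R b"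
    using x(3) by (simp_all add: scaleR_add_right[symmetric] eq_neg_iff_add_eq_0[symmetric])
  then have "0 \<in> S_op \<gamma> A B (x + \<gamma> *\<^sub>R b)" unfolding S_op_def using x(1,2) by blast
  then show ?thesis by (auto simp: zer_def)
qed

text \<open>The accepted test bounds the distance from \<zeta> to the new iterate by \<sigma> times
  that to the old one, with \<open>2 * \<gamma> * eps_b\<close> to spare; the rest is an expansion
  of squares. The point \<open>p\<close> is arbitrary: both zeros of \<open>S\<close> and the mean
  of \<open>zeta\<close> are substituted later.\<close>

lemma extragradient_descent:
  assumes "extragradient (Suc k)"
  shows "2 * ((zeta (Suc k) - p) \<bullet> (\<gamma> *\<^sub>R (as (Suc k) + bs (Suc k)))) + 2 * \<gamma> * eps_b (Suc k)
    + (1 - \<sigma>\<^sup>2) * (norm (zeta (Suc k) - zs k))\<^sup>2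
    \<le> (norm (zs k - p))\<^sup>2 - (norm (zs (Suc k) - p))\<^sup>2"
proof -
  define z \<zeta> v where "z = zs k" and "\<zeta> = zeta (Suc k)" and "v = \<gamma> *\<^sub>R (as (Suc k) + bs (Suc k))"
  have z': "zs (Suc k) = z - v" using assms by (simp add: zs_Suc z_def v_def)
  have "\<gamma> *\<^sub>R bs (Suc k) + xs (Suc k) - z = \<zeta> - (z - v)"
    using step_eq[of "Suc k"] by (simp add: \<zeta>_def zeta_def v_def algebra_simps)
  moreover have "\<gamma> *\<^sub>R bs (Suc k) + ys (Suc k) - z = \<zeta> - z"
    by (simp add: \<zeta>_def zeta_def)
  moreover have "(norm (\<gamma> *\<^sub>R bs (Suc k) + xs (Suc k) - z))\<^sup>2 + 2 * \<gamma> * eps_b (Suc k)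
      \<le> \<sigma>\<^sup>2 * (norm (\<gamma> *\<^sub>R bs (Suc k) + ys (Suc k) - z))\<^sup>2"
    using assms by (simp add: extragradient_def accept_def z_def xs_def ys_def bs_def eps_b_def)
  ultimately have "(norm (\<zeta> - (z - v)))\<^sup>2 + 2 * \<gamma> * eps_b (Suc k) \<le> \<sigma>\<^sup>2 * (norm (\<zeta> - z))\<^sup>2"
    by (simp only:)
  moreover have "(norm (z - p))\<^sup>2 - (norm (z - v - p))\<^sup>2 =
      2 * ((\<zeta> - p) \<bullet> v) + (norm (\<zeta> - z))\<^sup>2 - (norm (\<zeta> - (z - v)))\<^sup>2"
    by (simp add: power2_norm_eq_inner inner_simps inner_commute algebra_simps)
  ultimately show ?thesis
    unfolding z' z_def[symmetric] \<zeta>_def[symmetric] v_def[symmetric] by (simp add: algebra_simps)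
qed

section \<open>Telescoped estimates over the extragradient steps\<close>

lemma finite_E: "finite (E k)"
  by (simp add: E_def)

lemma E_0: "E 0 = {}"
  by (simp add: E_def extragradient_def)

lemma E_Suc: "E (Suc k) = (if extragradient (Suc k) then insert (Suc k) (E k) else E k)"
  by (auto simp: E_def le_Suc_eq)

lemma Suc_notin_E: "Suc k \<notin> E k"
  by (simp add: E_def)

lemma descent_sum:
  "(\<Sum>l\<in>E k. 2 * ((zeta l - p) \<bullet> (\<gamma> *\<^sub>R (as l + bs l))) + 2 * \<gamma> * eps_b l
      + (1 - \<sigma>\<^sup>2) * (norm (zeta l - zs (l - 1)))\<^sup>2)
    \<le> (norm (z0 - p))\<^sup>2 - (norm (zs k - p))\<^sup>2"
proof (induction k)
  case 0
  then show ?case by (simp add: E_0 zs_0)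
next
  case (Suc k)
  show ?case
  proof (cases "extragradient (Suc k)")
    case True
    then show ?thesis
      using Suc extragradient_descent[OF True, of p] Suc_notin_E[of k]
      by (simp add: E_Suc finite_E del: inner_scaleR_right)
  next
    case False
    then show ?thesis using Suc by (simp add: E_Suc zs_Suc)
  qed
qed

lemma step_sum: "(\<Sum>l\<in>E k. \<gamma> *\<^sub>R (as l + bs l)) = z0 - zs k"
  by (induction k) (simp_all add: E_0 zs_0 E_Suc zs_Suc finite_E Suc_notin_E algebra_simps)

lemma fejer:
  assumes "p \<in> zer (S_op \<gamma> A B)"
  shows "(\<Sum>l\<in>E k. (1 - \<sigma>\<^sup>2) * (norm (zeta l - zs (l - 1)))\<^sup>2) + (norm (zs k - p))\<^sup>2 \<le> (norm (z0 - p))\<^sup>2"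
proof -
  have "(\<Sum>l\<in>E k. (1 - \<sigma>\<^sup>2) * (norm (zeta l - zs (l - 1)))\<^sup>2) \<le>
      (\<Sum>l\<in>E k. 2 * ((zeta l - p) \<bullet> (\<gamma> *\<^sub>R (as l + bs l))) + 2 * \<gamma> * eps_b l
      + (1 - \<sigma>\<^sup>2) * (norm (zeta l - zs (l - 1)))\<^sup>2)"
  proof (rule sum_mono)
    fix l
    show "(1 - \<sigma>\<^sup>2) * (norm (zeta l - zs (l - 1)))\<^sup>2 \<le>
      2 * ((zeta l - p) \<bullet> (\<gamma> *\<^sub>R (as l + bs l))) + 2 * \<gamma> * eps_b l
      + (1 - \<sigma>\<^sup>2) * (norm (zeta l - zs (l - 1)))\<^sup>2"
      using zer_S_inner[OF assms, of l] by linarith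
  qed
  then show ?thesis using descent_sum[where p = p and k = k] by linarith
qed

lemma zs_dist_le:
  assumes "p \<in> zer (S_op \<gamma> A B)"
  shows "norm (zs k - p) \<le> norm (z0 - p)"
proof -
  have "0 \<le> (\<Sum>l\<in>E k. (1 - \<sigma>\<^sup>2) * (norm (zeta l - zs (l - 1)))\<^sup>2)"
    using sigma_sq_less by (intro sum_nonneg) simp
  then have "(norm (zs k - p))\<^sup>2 \<le> (norm (z0 - p))\<^sup>2" using fejer[OF assms, of k] by linarith
  then show ?thesis by (rule power2_le_imp_le) simp
qed

text \<open>A single term of the sum in \<open>fejer\<close> gives the factor \<open>sqrt M\<close>;
  the 2 comes from passing from \<open>zs (l - 1)\<close> through \<open>p\<close> to
  \<open>z0\<close>.\<close>

lemma zeta_dist_le: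
  assumes "p \<in> zer (S_op \<gamma> A B)" "l \<in> E k"
  shows "norm (zeta l - z0) \<le> (sqrt M + 2) * norm (z0 - p)"
proof -
  have "(1 - \<sigma>\<^sup>2) * (norm (zeta l - zs (l - 1)))\<^sup>2 \<le>
      (\<Sum>l\<in>E k. (1 - \<sigma>\<^sup>2) * (norm (zeta l - zs (l - 1)))\<^sup>2)"
    using assms(2) sigma_sq_less
    by (intro member_le_sum[where f = "\<lambda>l. (1 - \<sigma>\<^sup>2) * (norm (zeta l - zs (l - 1)))\<^sup>2"]) (auto simp: finite_E)
  also have "\<dots> \<le> (norm (z0 - p))\<^sup>2"
    using fejer[OF assms(1), of k] by (smt (verit) zero_le_power2)
  finally have "(norm (zeta l - zs (l - 1)))\<^sup>2 \<le> (1 / (1 - \<sigma>\<^sup>2)) * (norm (z0 - p))\<^sup>2"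
    using sigma_sq_less by (simp add: field_simps)
  also have "\<dots> \<le> M * (norm (z0 - p))\<^sup>2"
    by (rule mult_right_mono[OF inverse_one_minus_sigma_sq]) simp
  also have "\<dots> = (sqrt M * norm (z0 - p))\<^sup>2"
    using M_ge_2 by (simp add: power_mult_distrib)
  finally have "norm (zeta l - zs (l - 1)) \<le> sqrt M * norm (z0 - p)"
    by (rule power2_le_imp_le) (use M_ge_2 in simp)
  moreover have "norm (zeta l - z0) \<le> norm (zeta l - zs (l - 1)) + (norm (zs (l - 1) - p) + norm (z0 - p))"
    using norm_triangle_ineq[of "zeta l - zs (l - 1)" "zs (l - 1) - z0"]
      norm_triangle_ineq4[of "zs (l - 1) - p" "z0 - p"] by simp
  ultimately show ?thesis using zs_dist_le[OF assms(1), of "l - 1"] by (simp add: algebra_simps)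
qed

lemma mean_eq_avg: "mean u k = avg (E k) u"
  by (simp add: mean_def avg_def)

lemma erg_eps_a_eq: "erg_eps_a k = cov (E k) ys as / real (card (E k))"
  unfolding erg_eps_a_def mean_eq_avg cov_def by (subst (1) avg_def) (simp add: divide_inverse mult.commute)

lemma erg_eps_b_eq: "erg_eps_b k = ((\<Sum>l\<in>E k. eps_b l) + cov (E k) xs bs) / real (card (E k))"
  unfolding erg_eps_b_def mean_eq_avg cov_def
  by (subst (1) avg_def) (simp add: divide_inverse mult.commute sum.distrib)

subsection \<open>Ergodic iterates and null steps\<close>

text \<open>The pointwise inequalities are summed, and \<open>cov_shift\<close> splits the sum into
  the product of means and a covariance, which becomes the enlargement error.\<close>

lemma ergodic_enlargement:
  assumes "E k \<noteq> {}"
  shows "avg (E k) as \<in> enlargement (erg_eps_a k) A (avg (E k) ys)"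
    and "avg (E k) bs \<in> enlargement (erg_eps_b k) B (avg (E k) xs)"
proof -
  note fin = finite_E[of k]
  have N: "0 < real (card (E k))" using assms fin by (simp add: card_gt_0_iff)
  show "avg (E k) as \<in> enlargement (erg_eps_a k) A (avg (E k) ys)"
    unfolding enlargement_def
  proof (intro CollectI allI impI)
    fix q r assume "r \<in> A q"
    then have "0 \<le> (\<Sum>l\<in>E k. (ys l - q) \<bullet> (as l - r))"
      by (intro sum_nonneg A_mono as_mem)
    then show "- erg_eps_a k \<le> (avg (E k) ys - q) \<bullet> (avg (E k) as - r)"
      unfolding cov_shift[OF fin assms] erg_eps_a_eq using N by (simp add: field_simps)
  qed
  show "avg (E k) bs \<in> enlargement (erg_eps_b k) B (avg (E k) xs)"
    unfolding enlargement_def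
  proof (intro CollectI allI impI)
    fix q r assume "r \<in> B q"
    then have "(\<Sum>l\<in>E k. - eps_b l) \<le> (\<Sum>l\<in>E k. (xs l - q) \<bullet> (bs l - r))"
      by (intro sum_mono bs_relative)
    then show "- erg_eps_b k \<le> (avg (E k) xs - q) \<bullet> (avg (E k) bs - r)"
      unfolding cov_shift[OF fin assms] erg_eps_b_eq using N by (simp add: sum_negf field_simps)
  qed
qed

lemma erg_eps_a_nonneg: "0 \<le> erg_eps_a k"
proof (cases "E k = {}")
  case False
  then have "0 \<le> cov (E k) ys as" by (intro cov_nonneg finite_E A_mono as_mem)
  then show ?thesis by (simp add: erg_eps_a_eq)
qed (simp add: erg_eps_a_eq)

text \<open>The monotone part \<open>C + F1\<close> of \<open>B\<close> contributes a nonnegative covariance, and the cocoercive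
  part is compared with the value of \<open>F2\<close> at the mean.\<close>

lemma erg_eps_b_nonneg: "0 \<le> erg_eps_b k"
proof (cases "E k = {}")
  case False
  note fin = finite_E[of k]
  have "\<exists>c u. c \<in> C (xs l) \<and> bs l = (c + F1 (xs l)) + F2 u \<and> eps_b l = (norm (u - xs l))\<^sup>2 / (4 * \<eta>)" for l
    by (rule bs_decomposition[of l]) blast
  then obtain c u where cu: "\<And>l. c l \<in> C (xs l)" "\<And>l. bs l = (c l + F1 (xs l)) + F2 (u l)"
    "\<And>l. eps_b l = (norm (u l - xs l))\<^sup>2 / (4 * \<eta>)" by metis
  have "bs = (\<lambda>l. (c l + F1 (xs l)) + F2 (u l))" using cu(2) by (intro ext)
  then have "cov (E k) xs bs = cov (E k) xs (\<lambda>l. c l + F1 (xs l)) + cov (E k) xs (\<lambda>l. F2 (u l))"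
    by (simp only: cov_add_right)
  moreover have "0 \<le> cov (E k) xs (\<lambda>l. c l + F1 (xs l))"
    by (intro cov_nonneg fin False C_F1_mono cu(1))
  moreover have "(\<Sum>l\<in>E k. - eps_b l) \<le> cov (E k) xs (\<lambda>l. F2 (u l))"
  proof -
    let ?m = "avg (E k) xs"
    have "(\<Sum>l\<in>E k. - eps_b l) \<le> (\<Sum>l\<in>E k. (xs l - ?m) \<bullet> (F2 (u l) - F2 ?m))"
      unfolding cu(3) by (intro sum_mono cocoercive_shift F2 \<eta>)
    then show ?thesis unfolding cov_shift[OF fin False] by simp
  qed
  ultimately show ?thesis by (simp add: erg_eps_b_eq sum_negf)
qed (simp add: erg_eps_b_eq)

lemma ergodic_step_eq:
  "\<gamma> *\<^sub>R (avg (E k) as + avg (E k) bs) = avg (E k) xs - avg (E k) ys"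
  unfolding avg_add[symmetric] avg_diff[symmetric] avg_scaleR[symmetric] by (simp only: step_eq)

text \<open>The steps telescope to \<open>z0 - zs k\<close>, at most twice the distance from
  \<open>z0\<close> to any zero of \<open>S\<close>; dividing by \<open>N\<close> gives the first
  bound. For the second, the summed errors are bounded by the squared distance from
  \<open>z0\<close> to the mean of \<open>zeta\<close>.\<close>

lemma ergodic_bounds:
  assumes "E k \<noteq> {}"
  defines "N \<equiv> real (card (E k))" and "d \<equiv> infdist z0 (zer (S_op \<gamma> A B))"
  shows "norm (avg (E k) xs - avg (E k) ys) \<le> 2 * d / N"
    and "\<gamma> * (erg_eps_a k + erg_eps_b k) \<le> (M + 4) * d\<^sup>2 / N"
proof -
  note fin = finite_E[of k]
  have N: "0 < N" using assms(1) fin by (simp add: N_def card_gt_0_iff)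
  have v: "avg (E k) (\<lambda>l. \<gamma> *\<^sub>R (as l + bs l)) = avg (E k) xs - avg (E k) ys"
    by (simp only: step_eq avg_diff)
  have "N * norm (avg (E k) xs - avg (E k) ys) = norm (z0 - zs k)"
    unfolding v[symmetric] step_sum[symmetric] sum_eq_avg[OF fin assms(1)] by (simp add: N_def)
  also have "norm (z0 - zs k) / 2 \<le> d"
    unfolding d_def
  proof (rule le_infdist[OF zer_S_nonempty])
    fix p assume p: "p \<in> zer (S_op \<gamma> A B)"
    show "norm (z0 - zs k) / 2 \<le> dist z0 p"
      using zs_dist_le[OF p, of k] norm_triangle_ineq4[of "z0 - p" "zs k - p"] by (simp add: dist_norm)
  qed
  then have "norm (z0 - zs k) \<le> 2 * d" by simp
  finally show "norm (avg (E k) xs - avg (E k) ys) \<le> 2 * d / N"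
    using N by (simp add: field_simps)
  \<comment> \<open>At the reference point \<open>m\<close> the inner products in
    \<open>descent_sum\<close> add up to the covariance of \<open>zeta\<close> with the steps, which
    \<open>splitting_identity\<close> turns into \<gamma> times the sum of the two
    covariances.\<close>
  define m where "m = avg (E k) zeta"
  have m: "m = avg (E k) ys + \<gamma> *\<^sub>R avg (E k) bs"
    by (simp add: m_def zeta_def[abs_def] avg_add avg_scaleR)
  have "\<gamma> * ((ys l - avg (E k) ys) \<bullet> (as l - avg (E k) as) + (xs l - avg (E k) xs) \<bullet> (bs l - avg (E k) bs))
      = (zeta l - m) \<bullet> (\<gamma> *\<^sub>R (as l + bs l) - avg (E k) (\<lambda>l. \<gamma> *\<^sub>R (as l + bs l)))" for l
  proof -
    have "\<gamma> *\<^sub>R ((as l - avg (E k) as) + (bs l - avg (E k) bs)) =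
        \<gamma> *\<^sub>R (as l + bs l) - \<gamma> *\<^sub>R (avg (E k) as + avg (E k) bs)"
      by (simp add: algebra_simps)
    also have "\<dots> = (xs l - avg (E k) xs) - (ys l - avg (E k) ys)"
      unfolding ergodic_step_eq step_eq by (simp add: algebra_simps)
    finally have *: "\<gamma> *\<^sub>R ((as l - avg (E k) as) + (bs l - avg (E k) bs)) =
        (xs l - avg (E k) xs) - (ys l - avg (E k) ys)" .
    have "\<gamma> *\<^sub>R (as l + bs l) - avg (E k) (\<lambda>l. \<gamma> *\<^sub>R (as l + bs l)) =
        \<gamma> *\<^sub>R ((as l - avg (E k) as) + (bs l - avg (E k) bs))"
      by (simp add: avg_scaleR avg_add algebra_simps)
    moreover have "zeta l - m = (ys l - avg (E k) ys) + \<gamma> *\<^sub>R (bs l - avg (E k) bs)"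
      by (simp add: m zeta_def algebra_simps)
    ultimately show ?thesis by (simp only: splitting_identity[OF *])
  qed
  then have "\<gamma> * (cov (E k) ys as + cov (E k) xs bs) = cov (E k) zeta (\<lambda>l. \<gamma> *\<^sub>R (as l + bs l))"
    by (simp add: cov_def m_def[symmetric] sum.distrib[symmetric] sum_distrib_left)
  also have "\<dots> = (\<Sum>l\<in>E k. (zeta l - m) \<bullet> (\<gamma> *\<^sub>R (as l + bs l)))"
    unfolding m_def by (rule cov_eq_sum[OF fin assms(1)])
  finally have cov_eq: "\<gamma> * (cov (E k) ys as + cov (E k) xs bs) =
      (\<Sum>l\<in>E k. (zeta l - m) \<bullet> (\<gamma> *\<^sub>R (as l + bs l)))" .
  have "erg_eps_a k + erg_eps_b k =
      ((cov (E k) ys as + cov (E k) xs bs) + (\<Sum>l\<in>E k. eps_b l)) / N"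
    unfolding erg_eps_a_eq erg_eps_b_eq N_def by (simp add: add_divide_distrib)
  then have "N * (erg_eps_a k + erg_eps_b k) =
      (cov (E k) ys as + cov (E k) xs bs) + (\<Sum>l\<in>E k. eps_b l)"
    using N by simp
  then have "2 * \<gamma> * (N * (erg_eps_a k + erg_eps_b k)) =
      2 * \<gamma> * ((cov (E k) ys as + cov (E k) xs bs) + (\<Sum>l\<in>E k. eps_b l))"
    by (rule arg_cong)
  then have "2 * N * (\<gamma> * (erg_eps_a k + erg_eps_b k)) =
      2 * (\<gamma> * (cov (E k) ys as + cov (E k) xs bs)) + 2 * (\<gamma> * (\<Sum>l\<in>E k. eps_b l))"
    by (simp add: algebra_simps)
  also have "\<dots> = (\<Sum>l\<in>E k. 2 * ((zeta l - m) \<bullet> (\<gamma> *\<^sub>R (as l + bs l))) + 2 * \<gamma> * eps_b l)"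
    unfolding cov_eq by (simp add: sum.distrib sum_distrib_left mult.assoc del: inner_scaleR_right)
  also have "\<dots> \<le> (\<Sum>l\<in>E k. 2 * ((zeta l - m) \<bullet> (\<gamma> *\<^sub>R (as l + bs l))) + 2 * \<gamma> * eps_b l
      + (1 - \<sigma>\<^sup>2) * (norm (zeta l - zs (l - 1)))\<^sup>2)"
  proof (rule sum_mono)
    fix l
    have "0 \<le> (1 - \<sigma>\<^sup>2) * (norm (zeta l - zs (l - 1)))\<^sup>2" using sigma_sq_less by simp
    then show "2 * ((zeta l - m) \<bullet> (\<gamma> *\<^sub>R (as l + bs l))) + 2 * \<gamma> * eps_b l
      \<le> 2 * ((zeta l - m) \<bullet> (\<gamma> *\<^sub>R (as l + bs l))) + 2 * \<gamma> * eps_b l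
      + (1 - \<sigma>\<^sup>2) * (norm (zeta l - zs (l - 1)))\<^sup>2" by linarith
  qed
  also have "\<dots> \<le> (norm (z0 - m))\<^sup>2"
    using descent_sum[where p = m and k = k] by (smt (verit) zero_le_power2)
  finally have eps_le: "2 * N * (\<gamma> * (erg_eps_a k + erg_eps_b k)) \<le> (norm (z0 - m))\<^sup>2" .
  have "N * (\<gamma> * (erg_eps_a k + erg_eps_b k)) / (M + 4) \<le> d\<^sup>2"
    unfolding d_def
  proof (rule le_infdist_power2[OF zer_S_nonempty])
    fix p assume p: "p \<in> zer (S_op \<gamma> A B)"
    have "norm (m - z0) \<le> (sqrt M + 2) * norm (z0 - p)"
      unfolding m_def by (rule norm_avg_diff_le[OF fin assms(1) zeta_dist_le[OF p]])
    then have "(norm (z0 - m))\<^sup>2 \<le> ((sqrt M + 2) * norm (z0 - p))\<^sup>2"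
      by (intro power_mono) (simp_all add: norm_minus_commute)
    also have "\<dots> = (sqrt M + 2)\<^sup>2 * (dist z0 p)\<^sup>2" by (simp add: power_mult_distrib dist_norm)
    also have "\<dots> \<le> 2 * (M + 4) * (dist z0 p)\<^sup>2"
    proof (rule mult_right_mono)
      \<comment> \<open>This says \<open>4 * sqrt M \<le> M + 4\<close>. The factor 2 in
        \<open>2 * (M + 4)\<close> cancels the one in \<open>eps_le\<close>.\<close>
      have "0 \<le> (sqrt M - 2)\<^sup>2" by simp
      moreover have "(sqrt M)\<^sup>2 = M" using M_ge_2 by simp
      ultimately show "(sqrt M + 2)\<^sup>2 \<le> 2 * (M + 4)" by (simp add: power2_eq_square algebra_simps)
    qed simp
    finally show "N * (\<gamma> * (erg_eps_a k + erg_eps_b k)) / (M + 4) \<le> (dist z0 p)\<^sup>2"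
      using eps_le M_ge_2 by (simp add: field_simps)
  qed
  then show "\<gamma> * (erg_eps_a k + erg_eps_b k) \<le> (M + 4) * d\<^sup>2 / N"
    using N M_ge_2 by (simp add: field_simps)
qed

lemma achieved_extragradient:
  assumes "extragradient k" "0 < \<rho>" "0 < \<epsilon>"
    and count: "2 * (infdist z0 (zer (S_op \<gamma> A B)) / \<rho>) \<le> real (card (E k))"
      "(M + 4) * ((infdist z0 (zer (S_op \<gamma> A B)))\<^sup>2 / (\<gamma> * \<epsilon>)) \<le> real (card (E k))"
  shows "achieved \<rho> \<epsilon> k"
proof -
  define N d where "N = real (card (E k))" and "d = infdist z0 (zer (S_op \<gamma> A B))"
  have ne: "E k \<noteq> {}" using assms(1) by (auto simp: E_def)
  then have N: "0 < N" by (simp add: N_def card_gt_0_iff finite_E)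
  have "2 * d / N \<le> \<rho>" using count(1) N assms by (simp add: field_simps N_def d_def)
  with ergodic_bounds(1)[OF ne] have "norm (avg (E k) xs - avg (E k) ys) \<le> \<rho>"
    by (simp add: N_def d_def)
  moreover have "(M + 4) * d\<^sup>2 / N \<le> \<gamma> * \<epsilon>"
    using count(2) N \<gamma> assms by (simp add: field_simps N_def d_def)
  with ergodic_bounds(2)[OF ne] have "\<gamma> * (erg_eps_a k + erg_eps_b k) \<le> \<gamma> * \<epsilon>"
    by (simp add: N_def d_def)
  then have "erg_eps_a k + erg_eps_b k \<le> \<epsilon>" using \<gamma> by simp
  moreover have "\<gamma> * norm (avg (E k) as + avg (E k) bs) = norm (avg (E k) xs - avg (E k) ys)"
    unfolding ergodic_step_eq[symmetric] using \<gamma> by simp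
  ultimately show ?thesis
    using assms(1) ergodic_enlargement[OF ne] erg_eps_a_nonneg erg_eps_b_nonneg
    by (simp add: achieved_def tolerances_def mean_eq_avg)
qed

lemma achieved_null:
  assumes "\<not> extragradient k" "1 \<le> k"
    and small: "(1 + M)\<^sup>2 * \<tau>s (k - 1) \<le> \<rho>\<^sup>2" "\<tau>s (k - 1) \<le> 2 * \<gamma> * \<epsilon>" and "0 < \<rho>"
  shows "achieved \<rho> \<epsilon> k"
proof -
  define \<tau> z where "\<tau> = \<tau>s (k - 1)" and "z = zs (k - 1)"
  \<comment> \<open>Since \<open>xs k - ys k = e - f\<close>, it suffices to bound both:
    \<open>e\<close> by the inner tolerance, and \<open>f\<close> because the failed test keeps
    \<open>\<sigma> * norm f\<close> below a quantity bounded by that tolerance.\<close>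
  define e f where "e = \<gamma> *\<^sub>R bs k + xs k - z" and "f = \<gamma> *\<^sub>R bs k + ys k - z"
  have \<tau>: "0 < \<tau>" by (simp add: \<tau>_def taus_pos)
  have ef: "(norm e)\<^sup>2 + 2 * \<gamma> * eps_b k \<le> \<tau>" using residual_le[of k] by (simp add: e_def z_def \<tau>_def)
  have eps0: "0 \<le> 2 * \<gamma> * eps_b k" using eps_b_nonneg \<gamma> by simp
  have "\<not> (norm e)\<^sup>2 + 2 * \<gamma> * eps_b k \<le> \<sigma>\<^sup>2 * (norm f)\<^sup>2"
    using assms(1,2) by (simp add: extragradient_def accept_def e_def f_def z_def xs_def ys_def bs_def eps_b_def)
  then have "(\<sigma> * norm f)\<^sup>2 \<le> \<tau>" using ef by (simp add: power_mult_distrib)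
  then have "\<sigma> * norm f \<le> sqrt \<tau>" by (rule real_le_rsqrt)
  then have "norm f \<le> (1 / \<sigma>) * sqrt \<tau>" using \<sigma> by (simp add: field_simps)
  also have "\<dots> \<le> M * sqrt \<tau>" using M2 \<tau> by (intro mult_right_mono) auto
  finally have f: "norm f \<le> M * sqrt \<tau>" .
  have e: "norm e \<le> sqrt \<tau>" using ef eps0 by (intro real_le_rsqrt) simp
  have "norm (xs k - ys k) \<le> norm e + norm f"
    using norm_triangle_ineq4[of e f] by (simp add: e_def f_def)
  also have "\<dots> \<le> (1 + M) * sqrt \<tau>" using e f by (simp add: algebra_simps)
  also have "\<dots> \<le> \<rho>"
  proof (rule power2_le_imp_le)
    show "((1 + M) * sqrt \<tau>)\<^sup>2 \<le> \<rho>\<^sup>2" using small(1) \<tau> by (simp add: power_mult_distrib \<tau>_def)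
  qed (use assms in simp)
  finally have "norm (xs k - ys k) \<le> \<rho>" .
  moreover have "2 * \<gamma> * eps_b k \<le> 2 * \<gamma> * \<epsilon>"
    using ef small(2) zero_le_power2[of "norm e"] unfolding \<tau>_def by linarith
  then have "eps_b k \<le> \<epsilon>" using \<gamma> by simp
  moreover have "\<gamma> * norm (as k + bs k) = norm (xs k - ys k)"
    unfolding step_eq[symmetric] using \<gamma> by simp
  moreover have "as k \<in> enlargement 0 A (ys k)" "bs k \<in> enlargement (eps_b k) B (xs k)"
    using A_mono[OF as_mem[of k]] bs_relative by (auto simp: enlargement_def)
  ultimately show ?thesis
    using assms(1) eps_b_nonneg by (simp add: achieved_def tolerances_def)
qed

section \<open>Counting extragradient and null steps\<close>

lemma card_E_le: "card (E k) \<le> k"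
  by (induction k) (auto simp: E_0 E_Suc finite_E Suc_notin_E)

text \<open>The exponent is the number of null steps so far; \<open>card_E_le\<close> keeps the
  truncated subtraction exact.\<close>

lemma taus_eq: "\<tau>s k = \<theta> ^ (k - card (E k)) * \<tau>0"
proof (induction k)
  case (Suc k)
  then show ?case
    using card_E_le[of k] by (simp add: taus_Suc E_Suc finite_E Suc_notin_E Suc_diff_le)
qed (simp add: taus_0)

text \<open>An extragradient step bringing their number to \<open>N\<close> would succeed, and so
  would a null step preceded by \<open>n\<close> null steps, because \<tau> is then small
  enough.\<close>

lemma not_achieved_count:
  assumes pos: "0 < \<rho>" "0 < \<epsilon>"
    and N: "2 * (infdist z0 (zer (S_op \<gamma> A B)) / \<rho>) \<le> real N"
      "(M + 4) * ((infdist z0 (zer (S_op \<gamma> A B)))\<^sup>2 / (\<gamma> * \<epsilon>)) \<le> real N"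
    and n: "(1 + M)\<^sup>2 * (\<theta> ^ n * \<tau>0) \<le> \<rho>\<^sup>2" "\<theta> ^ n * \<tau>0 \<le> 2 * \<gamma> * \<epsilon>"
    and not: "\<And>i. 1 \<le> i \<Longrightarrow> i \<le> k \<Longrightarrow> \<not> achieved \<rho> \<epsilon> i"
  shows "card (E k) \<le> N \<and> k - card (E k) \<le> n"
  using not
proof (induction k)
  case 0
  then show ?case by (simp add: E_0)
next
  case (Suc k)
  then have IH: "card (E k) \<le> N" "k - card (E k) \<le> n" by auto
  have na: "\<not> achieved \<rho> \<epsilon> (Suc k)" using Suc.prems by simp
  show ?case
  proof (cases "extragradient (Suc k)")
    case True
    have card: "card (E (Suc k)) = Suc (card (E k))" using True by (simp add: E_Suc finite_E Suc_notin_E)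
    have "\<not> N \<le> card (E (Suc k))"
      using achieved_extragradient[OF True pos] N na by (meson of_nat_mono order_trans)
    then show ?thesis using IH card by simp
  next
    case False
    have "k - card (E k) \<noteq> n"
    proof
      assume "k - card (E k) = n"
      then have "\<tau>s (Suc k - 1) = \<theta> ^ n * \<tau>0" by (simp add: taus_eq)
      then show False using achieved_null[OF False, of \<rho> \<epsilon>] n na pos by simp
    qed
    then show ?thesis using IH False by (simp add: E_Suc)
  qed
qed

text \<open>\<tau> changes only at null steps. An unsuccessful one started from a \<tau> violating a
  smallness condition of \<open>achieved_null\<close>, and it costs just one factor
  \<theta>.\<close>

lemma tau_lower:
  assumes "0 < \<rho>" "0 < \<epsilon>" and not: "\<And>i. 1 \<le> i \<Longrightarrow> i \<le> k \<Longrightarrow> \<not> achieved \<rho> \<epsilon> i"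
  shows "\<tau>s k = \<tau>0 \<or> \<rho>\<^sup>2 * \<theta> \<le> (1 + M)\<^sup>2 * \<tau>s k \<or> 2 * \<gamma> * \<epsilon> * \<theta> \<le> \<tau>s k"
  using not
proof (induction k)
  case (Suc k)
  have na: "\<not> achieved \<rho> \<epsilon> (Suc k)" using Suc.prems by simp
  show ?case
  proof (cases "extragradient (Suc k)")
    case True
    then show ?thesis using Suc by (simp add: taus_Suc)
  next
    case False
    then have "\<rho>\<^sup>2 < (1 + M)\<^sup>2 * \<tau>s k \<or> 2 * \<gamma> * \<epsilon> < \<tau>s k"
      using achieved_null[OF False, of \<rho> \<epsilon>] na assms(1) by fastforce
    then have "\<rho>\<^sup>2 * \<theta> \<le> (1 + M)\<^sup>2 * \<tau>s k * \<theta> \<or> 2 * \<gamma> * \<epsilon> * \<theta> \<le> \<tau>s k * \<theta>"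
      using \<theta> by (meson less_imp_le mult_right_mono)
    then show ?thesis using False by (simp add: taus_Suc mult_ac)
  qed
qed (simp add: taus_0)

subsection \<open>Complexity\<close>

context
  fixes \<rho> \<epsilon> :: real
  assumes \<rho>: "0 < \<rho>" and \<epsilon>: "0 < \<epsilon>"
begin

definition logQ :: real where
  "logQ = max (log_plus (sqrt \<tau>0 / \<rho>)) (log_plus (\<tau>0 / (\<gamma> * \<epsilon>)))"

lemma logQ_nonneg: "0 \<le> logQ"
  using log_plus_nonneg by (auto simp: logQ_def le_max_iff_disj)

text \<open>The common exponent \<open>2 * logQ\<close> arises from squaring in the first estimate,
  whose logarithm contains \<open>sqrt \<tau>0\<close>, and from weakening in the second.\<close>

lemma exp_logQ: "\<tau>0 \<le> \<rho>\<^sup>2 * exp (2 * logQ)" "\<tau>0 \<le> \<gamma> * \<epsilon> * exp (2 * logQ)"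
proof -
  have "sqrt \<tau>0 / \<rho> \<le> exp (log_plus (sqrt \<tau>0 / \<rho>))" by (rule le_exp_log_plus)
  also have "\<dots> \<le> exp logQ" by (simp add: logQ_def)
  finally have "sqrt \<tau>0 \<le> \<rho> * exp logQ" using \<rho> by (simp add: field_simps)
  then have "(sqrt \<tau>0)\<^sup>2 \<le> (\<rho> * exp logQ)\<^sup>2" using \<tau>0 by (intro power_mono) auto
  then show "\<tau>0 \<le> \<rho>\<^sup>2 * exp (2 * logQ)"
    using \<tau>0 by (simp add: power_mult_distrib exp_double)
  have "\<tau>0 / (\<gamma> * \<epsilon>) \<le> exp (log_plus (\<tau>0 / (\<gamma> * \<epsilon>)))" by (rule le_exp_log_plus)
  also have "\<dots> \<le> exp (2 * logQ)" using logQ_nonneg by (simp add: logQ_def)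
  finally show "\<tau>0 \<le> \<gamma> * \<epsilon> * exp (2 * logQ)" using \<gamma> \<epsilon> by (simp add: field_simps)
qed

text \<open>Merges the cases of \<open>tau_lower\<close>, so that the current \<tau> in the inner
  iteration count can be traded for \<open>\<tau>0\<close>.\<close>

lemma tau_ratio:
  assumes "\<And>i. 1 \<le> i \<Longrightarrow> i \<le> k \<Longrightarrow> \<not> achieved \<rho> \<epsilon> i"
  shows "\<tau>0 \<le> \<tau>s k * ((1 + M)\<^sup>2 / \<theta> * exp (2 * logQ))"
proof -
  have big: "1 \<le> (1 + M)\<^sup>2" using M_ge_2 by (simp add: one_le_power)
  have e: "1 \<le> exp (2 * logQ)" using logQ_nonneg by simp
  consider "\<tau>s k = \<tau>0" | "\<rho>\<^sup>2 * \<theta> \<le> (1 + M)\<^sup>2 * \<tau>s k" | "2 * \<gamma> * \<epsilon> * \<theta> \<le> \<tau>s k"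
    using tau_lower[OF \<rho> \<epsilon> assms] by blast
  then show ?thesis
  proof cases
    case 1
    have "1 \<le> (1 + M)\<^sup>2 / \<theta>" using big \<theta> by (simp add: field_simps)
    then have "1 * 1 \<le> (1 + M)\<^sup>2 / \<theta> * exp (2 * logQ)" using e by (intro mult_mono) auto
    then have "\<tau>0 * 1 \<le> \<tau>0 * ((1 + M)\<^sup>2 / \<theta> * exp (2 * logQ))"
      using \<tau>0 by (intro mult_left_mono) auto
    then show ?thesis unfolding 1 by (simp only: mult_1_right)
  next
    case 2
    have "\<tau>0 \<le> (\<rho>\<^sup>2 * \<theta>) * (exp (2 * logQ) / \<theta>)" using exp_logQ(1) \<theta> by simp
    also have "\<dots> \<le> ((1 + M)\<^sup>2 * \<tau>s k) * (exp (2 * logQ) / \<theta>)"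
      using 2 \<theta> by (intro mult_right_mono) auto
    finally show ?thesis by (simp add: mult_ac)
  next
    case 3
    have "0 < \<gamma> * \<epsilon> * \<theta>" using \<gamma> \<epsilon> \<theta> by simp
    with 3 have "\<gamma> * \<epsilon> * \<theta> \<le> 1 * \<tau>s k" by linarith
    also have "\<dots> \<le> (1 + M)\<^sup>2 * \<tau>s k" using big taus_pos[of k] by (intro mult_right_mono) auto
    finally have 4: "\<gamma> * \<epsilon> * \<theta> \<le> (1 + M)\<^sup>2 * \<tau>s k" .
    have "\<tau>0 \<le> (\<gamma> * \<epsilon> * \<theta>) * (exp (2 * logQ) / \<theta>)" using exp_logQ(2) \<theta> by simp
    also have "\<dots> \<le> ((1 + M)\<^sup>2 * \<tau>s k) * (exp (2 * logQ) / \<theta>)"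
      using 4 \<theta> by (intro mult_right_mono) auto
    finally show ?thesis by (simp add: mult_ac)
  qed
qed

lemma outer_bound:
  defines "d \<equiv> infdist z0 (zer (S_op \<gamma> A B))"
  shows "\<exists>k\<ge>1. achieved \<rho> \<epsilon> k \<and> real k \<le> k_outer M \<theta> \<gamma> \<tau>0 d \<rho> \<epsilon>"
proof -
  define R where "R = max (d / \<rho>) (d\<^sup>2 / (\<gamma> * \<epsilon>))"
  define l where "l = ln (1 / \<theta>)"
  \<comment> \<open>\<open>exp X\<close> is the factor by which null steps must shrink
    \<open>\<tau>0\<close> for \<open>achieved_null\<close> to apply, and \<open>l\<close> is the
    logarithmic decrease per null step.\<close>
  define X where "X = 2 * ln (1 + M) + 2 * logQ"
  define N n where "N = nat \<lceil>(M + 4) * R\<rceil>" and "n = nat \<lceil>X / l\<rceil>"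
  have l: "0 < l" using \<theta> by (simp add: l_def)
  have d0: "0 \<le> d" by (simp add: d_def infdist_nonneg)
  have R0: "0 \<le> R" using d0 \<rho> by (simp add: R_def le_max_iff_disj)
  have lnM: "0 \<le> ln (1 + M)" "ln (1 + M) \<le> M" using M_ge_2 by (auto intro: ln_add_one_self_le_self)
  have X0: "0 \<le> X" using lnM logQ_nonneg by (simp add: X_def)
  have "0 \<le> (M + 4) * R" using M_ge_2 R0 by simp
  then have N: "(M + 4) * R \<le> real N" "real N \<le> (M + 4) * R + 1" unfolding N_def by linarith+
  have "0 \<le> X / l" using X0 l by simp
  then have n: "X / l \<le> real n" "real n \<le> X / l + 1" unfolding n_def by linarith+
  have "\<theta> ^ n * \<tau>0 = exp (- (real n * l)) * \<tau>0"
    using \<theta> by (simp add: l_def ln_div exp_of_nat_mult)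
  also have "\<dots> \<le> exp (- X) * \<tau>0"
    using n(1) l \<tau>0 by (intro mult_right_mono) (auto simp: field_simps)
  finally have "\<theta> ^ n * \<tau>0 * exp X \<le> exp (- X) * \<tau>0 * exp X" by (rule mult_right_mono) simp
  then have "\<theta> ^ n * \<tau>0 * exp X \<le> \<tau>0" by (simp add: exp_minus field_simps)
  moreover have "exp X = (1 + M)\<^sup>2 * exp (2 * logQ)"
    using M_ge_2 by (simp add: X_def exp_add exp_double)
  ultimately have small: "(1 + M)\<^sup>2 * (\<theta> ^ n * \<tau>0) * exp (2 * logQ) \<le> \<tau>0" by (simp add: mult_ac)
  have "(1 + M)\<^sup>2 * (\<theta> ^ n * \<tau>0) * exp (2 * logQ) \<le> \<rho>\<^sup>2 * exp (2 * logQ)"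
    using small exp_logQ(1) by linarith
  then have n1: "(1 + M)\<^sup>2 * (\<theta> ^ n * \<tau>0) \<le> \<rho>\<^sup>2" by simp
  have "(1 + M)\<^sup>2 * (\<theta> ^ n * \<tau>0) * exp (2 * logQ) \<le> \<gamma> * \<epsilon> * exp (2 * logQ)"
    using small exp_logQ(2) by linarith
  then have "(1 + M)\<^sup>2 * (\<theta> ^ n * \<tau>0) \<le> \<gamma> * \<epsilon>" by simp
  moreover have "1 * (\<theta> ^ n * \<tau>0) \<le> (1 + M)\<^sup>2 * (\<theta> ^ n * \<tau>0)"
    using \<theta> \<tau>0 M_ge_2 by (intro mult_right_mono) (auto simp: one_le_power)
  moreover have "0 < \<gamma> * \<epsilon>" using \<gamma> \<epsilon> by simp
  ultimately have n2: "\<theta> ^ n * \<tau>0 \<le> 2 * \<gamma> * \<epsilon>" by linarith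
  have "2 * (d / \<rho>) \<le> (M + 4) * R"
    using M_ge_2 d0 \<rho> by (intro mult_mono) (auto simp: R_def)
  then have N1: "2 * (d / \<rho>) \<le> real N" using N(1) by linarith
  have "(M + 4) * (d\<^sup>2 / (\<gamma> * \<epsilon>)) \<le> (M + 4) * R"
    using M_ge_2 by (intro mult_left_mono) (auto simp: R_def)
  then have N2: "(M + 4) * (d\<^sup>2 / (\<gamma> * \<epsilon>)) \<le> real N" using N(1) by linarith
  \<comment> \<open>Pigeonhole: \<open>N + n + 1\<close> iterations cannot consist of at most
    \<open>N\<close> extragradient and at most \<open>n\<close> null steps.\<close>
  have "\<exists>k\<ge>1. k \<le> Suc (N + n) \<and> achieved \<rho> \<epsilon> k"
  proof (rule ccontr)
    assume "\<not> ?thesis"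
    then have "card (E (Suc (N + n))) \<le> N \<and> Suc (N + n) - card (E (Suc (N + n))) \<le> n"
      by (intro not_achieved_count[OF \<rho> \<epsilon> N1[unfolded d_def] N2[unfolded d_def] n1 n2]) blast
    then show False by linarith
  qed
  then obtain k where k: "1 \<le> k" "k \<le> Suc (N + n)" "achieved \<rho> \<epsilon> k" by blast
  have "real k \<le> real N + real n + 1" using k(2) by linarith
  \<comment> \<open>The 3 collects the two ceilings and the extra iteration of the pigeonhole
    argument.\<close>
  also have "\<dots> \<le> (M + 4) * R + X / l + 3" using N(2) n(2) by linarith
  also have "\<dots> \<le> 5 * M * (1 + 1 / l) * (1 + R + logQ)"
  proof -
    have "(M + 4) * R \<le> 5 * M * R" using M_ge_2 R0 by (intro mult_right_mono) auto
    moreover have "X / l \<le> 5 * M * (1 + logQ) / l"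
    proof (rule divide_right_mono)
      have "2 * logQ \<le> 5 * M * logQ" using M_ge_2 logQ_nonneg by (intro mult_right_mono) auto
      then show "X \<le> 5 * M * (1 + logQ)" using lnM M_ge_2 by (simp add: X_def distrib_left)
    qed (use l in simp)
    moreover have "0 \<le> 5 * M * logQ" "0 \<le> 5 * M * R / l"
      using M_ge_2 logQ_nonneg R0 l by simp_all
    ultimately show ?thesis
      using M_ge_2 by (simp add: algebra_simps add_divide_distrib)
  qed
  also have "\<dots> = k_outer M \<theta> \<gamma> \<tau>0 d \<rho> \<epsilon>"
    by (simp add: k_outer_def outer_const_def R_def logQ_def l_def)
  finally show ?thesis using k by blast
qed

lemma inner_bound:
  assumes "1 \<le> k" and not: "\<And>i. 1 \<le> i \<Longrightarrow> i < k \<Longrightarrow> \<not> achieved \<rho> \<epsilon> i"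
  shows "real (inner_count k) \<le> k_inner M \<theta> \<gamma> \<tau>0
    (infdist z0 (zer (S_op \<gamma> A B))) (infdist z0 (zer B)) \<rho> \<epsilon>"
proof -
  define d e where "d = infdist z0 (zer (S_op \<gamma> A B))" and "e = infdist z0 (zer B)"
  define \<tau> z where "\<tau> = \<tau>s (k - 1)" and "z = zs (k - 1)"
  define D where "D = log_plus ((d + e) / sqrt \<tau>0)"
  define l where "l = ln (1 / \<theta>)"
  have \<tau>: "0 < \<tau>" by (simp add: \<tau>_def taus_pos)
  have de: "0 \<le> d" "0 \<le> e" by (simp_all add: d_def e_def infdist_nonneg)
  obtain p j where p: "\<And>q. q \<in> zer B \<Longrightarrow> norm (z - p) \<le> norm (z - q)"
    and stop: "inner_stop z \<tau> j"
    and j: "real j \<le> 2 + (M + 1/2) * log_plus (2 * M * (norm (z - p))\<^sup>2 / \<tau>)"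
    using inner_loop_terminates[OF \<tau>] by blast
  \<comment> \<open>The distance to \<open>p\<close> is at most that to any zero \<open>q\<close> of
    \<open>B\<close>, and \<open>z\<close> has moved at most \<open>2 * dist z0 s\<close> from
    \<open>z0\<close>. The infimum is taken first over \<open>q\<close>, then over
    \<open>s\<close>.\<close>
  have "norm (z - p) - e \<le> 2 * dist z0 s" if s: "s \<in> zer (S_op \<gamma> A B)" for s
  proof -
    have "norm (z - p) - 2 * dist z0 s \<le> dist z0 q" if q: "q \<in> zer B" for q
      using p[OF q] zs_dist_le[OF s, of "k - 1"] dist_triangle[of z q z0] dist_triangle[of z z0 s]
      by (simp add: z_def dist_norm norm_minus_commute)
    then have "norm (z - p) - 2 * dist z0 s \<le> e" unfolding e_def by (rule le_infdist[OF zer_B])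
    then show ?thesis by simp
  qed
  then have "(norm (z - p) - e) / 2 \<le> d"
    unfolding d_def by (intro le_infdist[OF zer_S_nonempty]) fastforce
  then have zp: "norm (z - p) \<le> 2 * (d + e)" using de by simp
  have "(d + e) / sqrt \<tau>0 \<le> exp D" by (simp add: D_def le_exp_log_plus)
  then have "d + e \<le> sqrt \<tau>0 * exp D" using \<tau>0 by (simp add: field_simps)
  then have "norm (z - p) \<le> 2 * (sqrt \<tau>0 * exp D)" by (intro order_trans[OF zp] mult_left_mono) auto
  then have "(norm (z - p))\<^sup>2 \<le> (2 * (sqrt \<tau>0 * exp D))\<^sup>2" by (intro power_mono) auto
  also have "\<dots> = \<tau>0 * (4 * exp (2 * D))"
    using \<tau>0 by (simp add: power_mult_distrib exp_double)
  also have "\<dots> \<le> (\<tau> * ((1 + M)\<^sup>2 / \<theta> * exp (2 * logQ))) * (4 * exp (2 * D))"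
    unfolding \<tau>_def using not assms(1) by (intro mult_right_mono tau_ratio) auto
  finally have "(norm (z - p))\<^sup>2 / \<tau> \<le> (1 + M)\<^sup>2 / \<theta> * exp (2 * logQ) * (4 * exp (2 * D))"
    using \<tau> by (simp add: field_simps)
  then have "2 * M * ((norm (z - p))\<^sup>2 / \<tau>) \<le> 2 * M * ((1 + M)\<^sup>2 / \<theta> * exp (2 * logQ) * (4 * exp (2 * D)))"
    using M_ge_2 by (intro mult_left_mono) auto
  \<comment> \<open>All factors go into one exponent, from which the bound on
    \<open>log_plus\<close> is read off; \<open>8 * M\<close> is \<open>2 * M\<close> times the 4
    above.\<close>
  also have "\<dots> = exp (ln (8 * M) + 2 * ln (1 + M) + l + 2 * D + 2 * logQ)"
    using M_ge_2 \<theta> by (simp add: exp_add exp_double l_def)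
  finally have V: "2 * M * (norm (z - p))\<^sup>2 / \<tau> \<le> exp (ln (8 * M) + 2 * ln (1 + M) + l + 2 * D + 2 * logQ)"
    by simp
  have l: "0 < l" using \<theta> by (simp add: l_def)
  have D: "0 \<le> D" by (simp add: D_def log_plus_nonneg)
  have lnM: "0 \<le> ln (1 + M)" "ln (1 + M) \<le> M" using M_ge_2 by (auto intro: ln_add_one_self_le_self)
  have ln8M: "0 \<le> ln (8 * M)" "ln (8 * M) \<le> M + 2"
  proof -
    have "ln (8 * M) = 3 * ln 2 + ln M"
      using M_ge_2 ln_realpow[of 2 3] by (simp add: ln_mult)
    moreover have "ln 2 \<le> (1::real)" using ln_le_minus_one[of 2] by simp
    moreover have "ln M \<le> M - 1" using M_ge_2 by (intro ln_le_minus_one) simp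
    ultimately show "ln (8 * M) \<le> M + 2" by linarith
  qed (use M_ge_2 in simp)
  have "log_plus (2 * M * (norm (z - p))\<^sup>2 / \<tau>) \<le> ln (8 * M) + 2 * ln (1 + M) + l + 2 * D + 2 * logQ"
    using V lnM ln8M l D logQ_nonneg
    by (smt (verit) exp_le_cancel_iff exp_ln log_plus_def)
  also have "\<dots> \<le> 3 * M + 2 + l + 2 * D + 2 * logQ" using lnM ln8M by linarith
  finally have "(M + 1/2) * log_plus (2 * M * (norm (z - p))\<^sup>2 / \<tau>) \<le>
      (M + 1/2) * (3 * M + 2 + l + 2 * D + 2 * logQ)"
    using M_ge_2 by (intro mult_left_mono) auto
  moreover have "inner_iters z \<tau> \<le> j"
    unfolding inner_iters_def using stop by (rule Least_le)
  ultimately have "real (inner_count k) \<le> 2 + (M + 1/2) * (3 * M + 2 + l + 2 * D + 2 * logQ)"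
    using j by (simp add: inner_count_def z_def \<tau>_def)
  also have "\<dots> \<le> 10 * M\<^sup>2 * (1 + l + D + logQ)"
  proof -
    have sq: "2 * M \<le> M\<^sup>2" using M_ge_2 by (simp add: power2_eq_square)
    then have coeff: "2 * (M + 1/2) \<le> 10 * M\<^sup>2" using M_ge_2 by (simp add: distrib_left)
    have "2 + (M + 1/2) * (3 * M + 2) = 3 * M\<^sup>2 + (7/2) * M + 3"
      by (simp add: algebra_simps power2_eq_square)
    also have "\<dots> \<le> 10 * M\<^sup>2" using sq M_ge_2 by simp
    finally have "2 + (M + 1/2) * (3 * M + 2) \<le> 10 * M\<^sup>2" .
    moreover have "(M + 1/2) * l \<le> 10 * M\<^sup>2 * l"
      using coeff l M_ge_2 by (intro mult_right_mono) auto
    moreover have "2 * (M + 1/2) * D \<le> 10 * M\<^sup>2 * D" "2 * (M + 1/2) * logQ \<le> 10 * M\<^sup>2 * logQ"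
      using coeff D logQ_nonneg by (intro mult_right_mono; simp)+
    ultimately show ?thesis by (simp add: algebra_simps)
  qed
  \<comment> \<open>Separates the \<theta>-dependent factor \<open>1 + l\<close>, which belongs to
    \<open>inner_const\<close>.\<close>
  also have "\<dots> \<le> 10 * M\<^sup>2 * ((1 + l) * (1 + D + logQ))"
    using l D logQ_nonneg by (intro mult_left_mono) (auto simp: algebra_simps)
  also have "\<dots> = k_inner M \<theta> \<gamma> \<tau>0 d e \<rho> \<epsilon>"
    by (simp add: k_inner_def inner_const_def l_def D_def logQ_def)
  finally show ?thesis by (simp add: d_def e_def)
qed

text \<open>Taking the least successful \<open>k\<close> makes \<open>inner_bound\<close> available
  for every iteration up to \<open>k\<close>, so one index serves both the outer and the total inner
  count.\<close>

lemma complexity: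
  defines "K \<equiv> k_outer M \<theta> \<gamma> \<tau>0 (infdist z0 (zer (S_op \<gamma> A B))) \<rho> \<epsilon>"
    and "J \<equiv> k_inner M \<theta> \<gamma> \<tau>0 (infdist z0 (zer (S_op \<gamma> A B))) (infdist z0 (zer B)) \<rho> \<epsilon>"
  shows "(\<exists>k\<ge>1. achieved \<rho> \<epsilon> k \<and> (\<forall>i\<in>{1..k}. inner_terminates i) \<and> real k \<le> K) \<and>
    (\<forall>k\<ge>1. (\<forall>i\<in>{1..<k}. \<not> achieved \<rho> \<epsilon> i) \<longrightarrow>
      inner_terminates k \<and> real (inner_count k) \<le> J \<and> real (F2_evals k) \<le> J) \<and>
    (\<exists>k\<ge>1. achieved \<rho> \<epsilon> k \<and> (\<forall>i\<in>{1..k}. inner_terminates i) \<and>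
      real (\<Sum>i=1..k. inner_count i) \<le> K * J)"
proof -
  obtain k0 where k0: "1 \<le> k0" "achieved \<rho> \<epsilon> k0" "real k0 \<le> K"
    using outer_bound unfolding K_def by blast
  define k where "k = (LEAST k. 1 \<le> k \<and> achieved \<rho> \<epsilon> k)"
  have k: "1 \<le> k" "achieved \<rho> \<epsilon> k"
    using LeastI[of "\<lambda>k. 1 \<le> k \<and> achieved \<rho> \<epsilon> k"] k0 by (auto simp: k_def)
  have "k \<le> k0" using k0 by (auto simp: k_def intro: Least_le)
  then have kK: "real k \<le> K" using k0(3) by linarith
  have before: "\<not> achieved \<rho> \<epsilon> i" if "1 \<le> i" "i < k" for i
    using not_less_Least[of i "\<lambda>k. 1 \<le> k \<and> achieved \<rho> \<epsilon> k"] that by (auto simp: k_def)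
  have J: "real (inner_count i) \<le> J" if "1 \<le> i" "\<And>m. 1 \<le> m \<Longrightarrow> m < i \<Longrightarrow> \<not> achieved \<rho> \<epsilon> m" for i
    unfolding J_def using that by (intro inner_bound) auto
  have "real (\<Sum>i=1..k. inner_count i) = (\<Sum>i=1..k. real (inner_count i))" by simp
  also have "\<dots> \<le> (\<Sum>i=1..k. J)" using before by (intro sum_mono J) auto
  also have "\<dots> = real k * J" by simp
  \<comment> \<open>The bound on the natural number \<open>inner_count k\<close> also supplies
    \<open>0 \<le> J\<close>.\<close>
  also have "\<dots> \<le> K * J" using kK J[OF k(1) before] by (intro mult_right_mono) auto
  finally have "real (\<Sum>i=1..k. inner_count i) \<le> K * J" .
  moreover have "F2_evals i = inner_count i" for i
    by (simp add: F2_evals_def F2_queries_def inner_count_def)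
  ultimately show ?thesis using k kK J inner_terminates_always by auto
qed

end

end

theorem theorem4p4:
  fixes A C :: "'a::{real_inner,complete_space} \<Rightarrow> 'a set"
    and \<Omega> D1 :: "'a set" and F1 F2 :: "'a \<Rightarrow> 'a"
    and L \<eta> \<sigma> \<theta> \<gamma> \<tau>0 M \<rho> \<epsilon> :: real and z0 :: 'a
  defines "B \<equiv> drt_splitting.B C D1 F1 F2"
    and "d\<gamma> \<equiv> infdist z0 (zer (S_op \<gamma> A (drt_splitting.B C D1 F1 F2)))"
    and "db \<equiv> infdist z0 (zer (drt_splitting.B C D1 F1 F2))"
    and "achieved \<equiv> drt_splitting.achieved A C D1 F1 F2 \<Omega> \<eta> \<sigma> \<theta> \<gamma> z0 \<tau>0 \<rho> \<epsilon>"
    and "inner_terminates \<equiv> drt_splitting.inner_terminates A C F1 F2 \<Omega> \<eta> \<sigma> \<theta> \<gamma> z0 \<tau>0"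
    and "inner_count \<equiv> drt_splitting.inner_count A C F1 F2 \<Omega> \<eta> \<sigma> \<theta> \<gamma> z0 \<tau>0"
    and "F2_evals \<equiv> drt_splitting.F2_evals A C F1 F2 \<Omega> \<eta> \<sigma> \<theta> \<gamma> z0 \<tau>0"
  assumes "maximal_monotone A" and "maximal_monotone C"
    and "\<Omega> \<noteq> {}" and "closed \<Omega>" and "convex \<Omega>"
    and "op_dom C \<subseteq> \<Omega>" and "\<Omega> \<subseteq> D1"
    and "\<forall>z\<in>\<Omega>. \<forall>z'\<in>\<Omega>. 0 \<le> (z - z') \<bullet> (F1 z - F1 z')"
    and "L-lipschitz_on \<Omega> F1"
    and "0 < \<eta>" and "cocoercive \<eta> F2"
    and "zer B \<noteq> {}" and "zer (op_sum A B) \<noteq> {}"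
    and "0 < \<tau>0" and "0 < \<sigma>" and "\<sigma> < 1" and "0 < \<theta>" and "\<theta> < 1"
    and "0 < \<gamma>" and "\<gamma> \<le> 4 * \<eta> * \<sigma>\<^sup>2 / (1 + sqrt (1 + 16 * L\<^sup>2 * \<eta>\<^sup>2 * \<sigma>\<^sup>2))"
    and "max (1 / (1 - \<sigma>)) (1 / \<sigma>) \<le> M"
    and "0 < \<rho>" and "0 < \<epsilon>"
  shows "(\<exists>k\<ge>1. achieved k \<and> (\<forall>i\<in>{1..k}. inner_terminates i) \<and>
            real k \<le> k_outer M \<theta> \<gamma> \<tau>0 d\<gamma> \<rho> \<epsilon>) \<and>
         (\<forall>k\<ge>1. (\<forall>i\<in>{1..<k}. \<not> achieved i) \<longrightarrow>
            inner_terminates k \<and>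
            real (inner_count k) \<le> k_inner M \<theta> \<gamma> \<tau>0 d\<gamma> db \<rho> \<epsilon> \<and>
            real (F2_evals k) \<le> k_inner M \<theta> \<gamma> \<tau>0 d\<gamma> db \<rho> \<epsilon>) \<and>
         (\<exists>k\<ge>1. achieved k \<and> (\<forall>i\<in>{1..k}. inner_terminates i) \<and>
            real (\<Sum>i=1..k. inner_count i)
              \<le> k_outer M \<theta> \<gamma> \<tau>0 d\<gamma> \<rho> \<epsilon> * k_inner M \<theta> \<gamma> \<tau>0 d\<gamma> db \<rho> \<epsilon>)"
proof -
  interpret drt_convergence A C D1 F1 F2 \<Omega> \<eta> \<sigma> \<theta> \<gamma> z0 \<tau>0 L M
    by unfold_locales (use assms(8-)[unfolded B_def] in auto)
  show ?thesis
    unfolding assms(2-7)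
    by (rule complexity[OF \<open>0 < \<rho>\<close> \<open>0 < \<epsilon>\<close>])
qed

end
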